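(* Let $V$ be a connected braided vector space of diagonal type such that $\Delta(\mathfrak B(V))$ is an arithmetic root system. If the rank of $V$ is $2$, then $\mathfrak B(V)=F\oplus\mathfrak L(V)$.
   Context: $F$ is a field of characteristic zero. $V$ is a vector space over $F$ with basis $x_1,\dots,x_n$ ($n$ is the rank), with braiding of diagonal type $C(x_i\otimes x_j)=q_{ij}\,x_j\otimes x_i$, $q_{ij}\in F\setminus\{0\}$. $V$ is connected if the graph on $\{1,\dots,n\}$ with an edge between $i\neq j$ exactly when $q_{ij}q_{ji}\neq 1$ is connected. $\mathfrak B(V)$ is the Nichols algebra of $(V,C)$, i.e. the quotient of the tensor algebra $T(V)$ by the sum of the kernels of the quantum symmetrizers; it is $\mathbb N_0^n$-graded with $\deg x_i=e_i$, and "homogeneous" refers to this grading. For homogeneous $u,v$ of degrees $\alpha,\beta$ put $p_{uv}=\prod_{i,j}q_{ij}^{\alpha_i\beta_j}$. The braided bracket on $\mathfrak B(V)$ is the bilinear extension of $[x,y]=yx-p_{yx}xy$ ($x,y$ homogeneous). $\mathfrak L(V)$ is the smallest subspace of $\mathfrak B(V)$ containing $V$ and closed under $[\ ,\ ]$. $F$ also denotes $F\cdot 1\subset\mathfrak B(V)$. Root system: $\Delta^+(\mathfrak B(V))\subset\mathbb N_0^n$ is the set of degrees of the generators of a (Kharchenko) restricted PBW basis of $\mathfrak B(V)$ by homogeneous elements, and $\Delta(\mathfrak B(V))=\Delta^+\cup(-\Delta^+)$. It is called an arithmetic root system (Heckenberger) if the associated Weyl groupoid is full and finite; equivalently, if $\Delta(\mathfrak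 B(V))$ is finite (the PBW basis has finitely many generators). *)

theory Defs
  imports
    "HOL-Library.Poly_Mapping"
    "HOL-Analysis.Finite_Cartesian_Product"
    "HOL-Algebra.QuotRing"
    "HOL-Algebra.Algebraic_Closure_Type"
    "HOL-Combinatorics.Permutations"
begin

section \<open>The tensor algebra of a vector space with a basis indexed by a finite type\<close>

text \<open>
  The basis of \<open>V\<close> is \<open>(x i)\<close> for \<open>i :: 'n\<close>. A word \<open>[i1, ..., im]\<close> stands for the basis tensor
  \<open>x i1 \<otimes> ... \<otimes> x im\<close>, and \<open>T(V)\<close> is the type of finitely supported functions on words. Turning
  words into a monoid makes the library's convolution product the product of \<open>T(V)\<close>.
\<close>

instantiation list :: (type) monoid_add
begin

definition zero_list :: "'a list" where "zero_list = []"

definition plus_list :: "'a list \<Rightarrow> 'a list \<Rightarrow> 'a list" where "plus_list u v = u @ v"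

instance
  by standard (simp_all add: zero_list_def plus_list_def)

end

type_synonym ('n, 'a) tensor = "'n list \<Rightarrow>\<^sub>0 'a"

definition tscale :: "'a \<Rightarrow> ('n, 'a :: field) tensor \<Rightarrow> ('n, 'a) tensor" where
  "tscale c t = Poly_Mapping.map ((*) c) t"

lemma lookup_tscale [simp]: "poly_mapping.lookup (tscale c t) w = c * poly_mapping.lookup t w"
  by (simp add: tscale_def map.rep_eq when_def)

global_interpretation tensor: vector_space "tscale :: 'a \<Rightarrow> ('n, 'a :: field) tensor \<Rightarrow> _"
  defines tensor_span = tensor.span
  by standard
    (auto intro!: poly_mapping_eqI simp: lookup_add distrib_left distrib_right)

text \<open>Linear extension of a map given on basis words.\<close>

definition lin_ext :: "('n list \<Rightarrow> ('n, 'a :: field) tensor) \<Rightarrow> ('n, 'a) tensor \<Rightarrow> ('n, 'a) tensor" where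
  "lin_ext f t = (\<Sum>w\<in>Poly_Mapping.keys t. tscale (poly_mapping.lookup t w) (f w))"

definition tensor_power :: "nat \<Rightarrow> ('n, 'a :: field) tensor set" where
  "tensor_power m = {t. \<forall>w\<in>Poly_Mapping.keys t. length w = m}"

section \<open>Braiding and quantum symmetrizers\<close>

text \<open>\<open>braid q k\<close> is the braiding \<open>C\<close> acting on the tensor factors \<open>k\<close> and \<open>k + 1\<close> (counted from \<open>0\<close>).\<close>

definition braid :: "('n \<Rightarrow> 'n \<Rightarrow> 'a :: field) \<Rightarrow> nat \<Rightarrow> ('n, 'a) tensor \<Rightarrow> ('n, 'a) tensor" where
  "braid q k = lin_ext (\<lambda>w.
     Poly_Mapping.single (w[k := w ! Suc k, Suc k := w ! k]) (q (w ! k) (w ! Suc k)))"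

definition simple_product :: "nat list \<Rightarrow> nat \<Rightarrow> nat" where
  "simple_product ks = foldr (\<lambda>k f. transpose k (Suc k) \<circ> f) ks id"

definition reduced_expression :: "nat \<Rightarrow> (nat \<Rightarrow> nat) \<Rightarrow> nat list \<Rightarrow> bool" where
  "reduced_expression m \<sigma> ks \<longleftrightarrow>
     (\<forall>k\<in>set ks. Suc k < m) \<and> simple_product ks = \<sigma> \<and>
     (\<forall>ls. (\<forall>k\<in>set ls. Suc k < m) \<and> simple_product ls = \<sigma> \<longrightarrow> length ks \<le> length ls)"

text \<open>
  The lift of a permutation of \<open>{..<m}\<close> to an operator on the \<open>m\<close>-th tensor power along a reduced
  expression. As \<open>C\<close> satisfies the braid equation, the choice is immaterial (Matsumoto).
\<close>

definition braid_lift ::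
    "('n \<Rightarrow> 'n \<Rightarrow> 'a :: field) \<Rightarrow> nat \<Rightarrow> (nat \<Rightarrow> nat) \<Rightarrow> ('n, 'a) tensor \<Rightarrow> ('n, 'a) tensor" where
  "braid_lift q m \<sigma> = foldr (\<lambda>k f. braid q k \<circ> f) (SOME ks. reduced_expression m \<sigma> ks) id"

definition quantum_symmetrizer ::
    "('n \<Rightarrow> 'n \<Rightarrow> 'a :: field) \<Rightarrow> nat \<Rightarrow> ('n, 'a) tensor \<Rightarrow> ('n, 'a) tensor" where
  "quantum_symmetrizer q m t = (\<Sum>\<sigma> | \<sigma> permutes {..<m}. braid_lift q m \<sigma> t)"

section \<open>The Nichols algebra\<close>

definition nichols_ideal :: "('n \<Rightarrow> 'n \<Rightarrow> 'a :: field) \<Rightarrow> ('n, 'a) tensor set" where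
  "nichols_ideal q = tensor_span (\<Union>m. {t \<in> tensor_power m. quantum_symmetrizer q m t = 0})"

definition nichols_proj ::
    "('n \<Rightarrow> 'n \<Rightarrow> 'a :: field) \<Rightarrow> ('n, 'a) tensor \<Rightarrow> ('n, 'a) tensor set" where
  "nichols_proj q t = nichols_ideal q +>\<^bsub>ring_of_type_algebra\<^esub> t"

text \<open>
  The scalar multiplication and the bracket below are the operations induced on cosets, in the
  style of \<^const>\<open>rcoset_mult\<close>.
\<close>

definition nichols_algebra ::
    "('n \<Rightarrow> 'n \<Rightarrow> 'a :: field) \<Rightarrow> ('a, ('n, 'a) tensor set) module" where
  "nichols_algebra q = ring.extend (ring_of_type_algebra Quot nichols_ideal q)
     (module.fields (\<lambda>c A. \<Union>t\<in>A. nichols_proj q (tscale c t)))"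

text \<open>The image of the ground field \<open>F\<close>, and the image of \<open>V\<close>.\<close>

definition nichols_scalars :: "('n \<Rightarrow> 'n \<Rightarrow> 'a :: field) \<Rightarrow> ('n, 'a) tensor set set" where
  "nichols_scalars q =
     (\<lambda>c. c \<odot>\<^bsub>nichols_algebra q\<^esub> \<one>\<^bsub>nichols_algebra q\<^esub>) ` UNIV"

definition nichols_V :: "('n \<Rightarrow> 'n \<Rightarrow> 'a :: field) \<Rightarrow> ('n, 'a) tensor set set" where
  "nichols_V q = nichols_proj q ` tensor_power 1"

section \<open>The braided bracket and the braided Lie algebra of \<open>V\<close>\<close>

text \<open>
  Degrees live in \<open>int ^ 'n\<close>; \<open>bichar q\<close> is the bicharacter with \<open>bichar q (e i) (e j) = q i j\<close>,
  so that \<open>p\<^sub>u\<^sub>v = bichar q (deg u) (deg v)\<close>.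
\<close>

definition bichar :: "('n :: finite \<Rightarrow> 'n \<Rightarrow> 'a :: field) \<Rightarrow> int ^ 'n \<Rightarrow> int ^ 'n \<Rightarrow> 'a" where
  "bichar q \<alpha> \<beta> = (\<Prod>i\<in>UNIV. \<Prod>j\<in>UNIV. q i j powi (\<alpha> $ i * \<beta> $ j))"

definition wdeg :: "'n list \<Rightarrow> int ^ ('n :: finite)" where
  "wdeg w = (\<chi> i. int (count_list w i))"

text \<open>
  The bilinear map on \<open>T(V)\<close> with \<open>[x, y] = y x - p\<^sub>y\<^sub>x x y\<close> for homogeneous \<open>x\<close>, \<open>y\<close>; it suffices
  to prescribe it on words.
\<close>

definition tensor_bracket :: "('n :: finite \<Rightarrow> 'n \<Rightarrow> 'a :: field) \<Rightarrow>
    ('n, 'a) tensor \<Rightarrow> ('n, 'a) tensor \<Rightarrow> ('n, 'a) tensor" where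
  "tensor_bracket q x y = lin_ext (\<lambda>u. lin_ext (\<lambda>v.
     Poly_Mapping.single (v @ u) 1 -
     Poly_Mapping.single (u @ v) (bichar q (wdeg v) (wdeg u))) y) x"

definition nichols_bracket :: "('n :: finite \<Rightarrow> 'n \<Rightarrow> 'a :: field) \<Rightarrow>
    ('n, 'a) tensor set \<Rightarrow> ('n, 'a) tensor set \<Rightarrow> ('n, 'a) tensor set" where
  "nichols_bracket q A B = (\<Union>x\<in>A. \<Union>y\<in>B. nichols_proj q (tensor_bracket q x y))"

definition braided_lie :: "('n :: finite \<Rightarrow> 'n \<Rightarrow> 'a :: field) \<Rightarrow> ('n, 'a) tensor set set" where
  "braided_lie q = \<Inter>{W. submodule W ring_of_type_algebra (nichols_algebra q) \<and> nichols_V q \<subseteq> W \<and>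
     (\<forall>A\<in>W. \<forall>B\<in>W. nichols_bracket q A B \<in> W)}"

section \<open>Connectedness\<close>

definition connected_braiding :: "('n \<Rightarrow> 'n \<Rightarrow> 'a :: field) \<Rightarrow> bool" where
  "connected_braiding q \<longleftrightarrow> (\<forall>i j. (i, j) \<in> {(i, j). i \<noteq> j \<and> q i j * q j i \<noteq> 1}\<^sup>*)"

section \<open>The Weyl groupoid and arithmetic root systems\<close>

text \<open>
  Heckenberger's Weyl groupoid of the bicharacter \<open>\<chi> = bichar q\<close> and the standard basis. Bases of
  the lattice are families \<open>E :: 'n \<Rightarrow> int ^ 'n\<close>. The number \<open>m\<close> attached to \<open>E\<close> and \<open>i \<noteq> j\<close> is the
  least one with \<open>(m + 1)\<^sub>r (r ^ m * s - 1) = 0\<close>, where \<open>r = \<chi>(E i, E i)\<close>,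
  \<open>s = \<chi>(E i, E j) \<chi>(E j, E i)\<close> and \<open>(m + 1)\<^sub>r = 1 + r + ... + r ^ m\<close>.
\<close>

definition cartan_cond ::
    "('n :: finite \<Rightarrow> 'n \<Rightarrow> 'a :: field) \<Rightarrow> ('n \<Rightarrow> int ^ 'n) \<Rightarrow> 'n \<Rightarrow> 'n \<Rightarrow> nat \<Rightarrow> bool" where
  "cartan_cond q E i j m \<longleftrightarrow>
     (\<Sum>k\<le>m. bichar q (E i) (E i) ^ k) *
     (bichar q (E i) (E i) ^ m * (bichar q (E i) (E j) * bichar q (E j) (E i)) - 1) = 0"

definition cartan_m ::
    "('n :: finite \<Rightarrow> 'n \<Rightarrow> 'a :: field) \<Rightarrow> ('n \<Rightarrow> int ^ 'n) \<Rightarrow> 'n \<Rightarrow> 'n \<Rightarrow> nat" where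
  "cartan_m q E i j = (LEAST m. cartan_cond q E i j m)"

definition reflection_defined ::
    "('n :: finite \<Rightarrow> 'n \<Rightarrow> 'a :: field) \<Rightarrow> ('n \<Rightarrow> int ^ 'n) \<Rightarrow> 'n \<Rightarrow> bool" where
  "reflection_defined q E i \<longleftrightarrow> (\<forall>j. j \<noteq> i \<longrightarrow> (\<exists>m. cartan_cond q E i j m))"

definition reflection ::
    "('n :: finite \<Rightarrow> 'n \<Rightarrow> 'a :: field) \<Rightarrow> ('n \<Rightarrow> int ^ 'n) \<Rightarrow> 'n \<Rightarrow> int ^ 'n \<Rightarrow> int ^ 'n" where
  "reflection q E i = (THE s. additive s \<and> s (E i) = - E i \<and>
     (\<forall>j. j \<noteq> i \<longrightarrow> s (E j) = E j + int (cartan_m q E i j) *s E i))"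

text \<open>
  A pair \<open>(T, E)\<close> is the morphism from \<open>E\<close> to \<open>T \<circ> E\<close> given by an automorphism \<open>T\<close> of the lattice;
  the Weyl groupoid is the smallest groupoid of such pairs satisfying the first three rules.
\<close>

inductive_set weyl_groupoid ::
    "('n :: finite \<Rightarrow> 'n \<Rightarrow> 'a :: field) \<Rightarrow> ((int ^ 'n \<Rightarrow> int ^ 'n) \<times> ('n \<Rightarrow> int ^ 'n)) set"
  for q :: "'n \<Rightarrow> 'n \<Rightarrow> 'a" where
  base: "(id, \<lambda>i. axis i 1) \<in> weyl_groupoid q"
| reflection: "(id, E) \<in> weyl_groupoid q \<Longrightarrow> reflection_defined q E i \<Longrightarrow>
    (reflection q E i, E) \<in> weyl_groupoid q"
| target: "(id, E) \<in> weyl_groupoid q \<Longrightarrow> reflection_defined q E i \<Longrightarrow>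
    (id, reflection q E i \<circ> E) \<in> weyl_groupoid q"
| compose: "(S, T \<circ> E) \<in> weyl_groupoid q \<Longrightarrow> (T, E) \<in> weyl_groupoid q \<Longrightarrow>
    (S \<circ> T, E) \<in> weyl_groupoid q"
| inverse: "(T, E) \<in> weyl_groupoid q \<Longrightarrow> (the_inv T, T \<circ> E) \<in> weyl_groupoid q"

text \<open>
  The root system of the Nichols algebra is arithmetic if its Weyl groupoid is full, that is, all
  reflections are defined at all bases occurring in it, and finite.
\<close>

definition arithmetic_root_system :: "('n :: finite \<Rightarrow> 'n \<Rightarrow> 'a :: field) \<Rightarrow> bool" where
  "arithmetic_root_system q \<longleftrightarrow>
     (\<forall>E i. (id, E) \<in> weyl_groupoid q \<longrightarrow> reflection_defined q E i) \<and>
     finite (weyl_groupoid q)"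

end

(*
  Let L be a subspace of the Nichols algebra that contains V and is closed under the bracket. All
  nonempty words lie in L, by induction on the length. A word with two distinct letters can be rotated,
  modulo L and up to a nonzero scalar, to x_i x_j w with i <> j; moving x_i and x_j behind w one
  after the other, or both at once, gives scalar multiples of w x_i x_j whose factors differ by
  q_ij q_ji <> 1, so the word is in L. A power x_i^(k+1) is in L as [x_i^k, x_i] is a multiple of
  it by 1 - q_ii^k; if this vanishes, then so does x_i^k, because q_ii <> 1: in characteristic
  zero q_ii = 1 would leave the reflection at i undefined.
*)

theory Submission
  imports Defs
begin

text \<open>Words are manipulated in T(V): a submodule of the Nichols algebra is replaced by its
  preimage S, so the bracket must be known to descend to cosets. It involves products on both sides
  and scalars depending on degrees, hence the ideal has to be two-sided and multigraded. The
  obstacle is that the symmetrizers are defined through an arbitrary choice of reduced expressions,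
  with no visible relation between degrees m and m + 1. This is why they are identified with
  \<open>qsym\<close>, which adds a letter at either end of a word: each end gives one side of the
  ideal property, and preservation of the letter content gives the grading. On x_i^m the same
  recursion yields the q_ii-factorial, which explains the vanishing of powers. Rank 2 enters because
  connectedness then gives q_ij q_ji <> 1 for all pairs of distinct letters. The sum with the
  scalars is direct because symmetrization preserves the constant term, and the image of the tensors
  without constant term contains V and is closed under the bracket.\<close>

global_interpretation tensor_pair: vector_space_pair
  "tscale :: 'a \<Rightarrow> ('n, 'a :: field) tensor \<Rightarrow> _"
  "tscale :: 'a \<Rightarrow> ('n, 'a) tensor \<Rightarrow> _"
  by unfold_locales

section \<open>Linear maps on the tensor algebra and their values on words\<close>

abbreviation tlinear :: "(('n, 'a :: field) tensor \<Rightarrow> ('n, 'a) tensor) \<Rightarrow> bool" where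
  "tlinear \<equiv> Vector_Spaces.linear tscale tscale"

abbreviation word :: "'n list \<Rightarrow> ('n, 'a :: field) tensor" where
  "word w \<equiv> Poly_Mapping.single w 1"

lemma single_eq_tscale_word: "Poly_Mapping.single w c = tscale c (word w)"
  by (intro poly_mapping_eqI) (simp add: lookup_single when_def)

lemma tscale_single [simp]: "tscale c (Poly_Mapping.single w d) = Poly_Mapping.single w (c * d)"
  by (intro poly_mapping_eqI) (simp add: lookup_single when_def)

lemma single_times_single:
  "Poly_Mapping.single u a * Poly_Mapping.single v b = Poly_Mapping.single (u @ v) (a * b :: 'a :: field)"
  by (simp add: mult_single plus_list_def)

lemma word_Nil: "word [] = 1"
  by (simp flip: single_one add: zero_list_def)

lemma tscale_eq_mult: "tscale c t = Poly_Mapping.single [] c * t"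
  by (simp add: tscale_def mult_map_scale_conv_mult zero_list_def)

text \<open>Multiples of the empty word are central. Together with \<open>tscale_eq_mult\<close>
  this lets a scalar pass to either factor of a product.\<close>

lemma single_Nil_commute: "Poly_Mapping.single [] c * t = t * Poly_Mapping.single [] c"
  for t :: "('n, 'a :: field) tensor"
proof (induction t rule: update_induct)
  case const
  then show ?case by simp
next
  case (update p w b)
  have "Poly_Mapping.update w b p = p + Poly_Mapping.single w b"
    using update by (intro poly_mapping_eqI)
      (auto simp: lookup_update lookup_add lookup_single when_def in_keys_iff)
  with update show ?case by (simp add: distrib_left distrib_right single_times_single mult.commute)
qed

lemma tscale_mult_left: "tscale c (s * t) = tscale c s * t"
  by (simp add: tscale_eq_mult mult.assoc)

lemma tscale_mult_right: "tscale c (s * t) = s * tscale c t"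
proof -
  have "Poly_Mapping.single [] c * (s * t) = s * (Poly_Mapping.single [] c * t)"
    by (metis single_Nil_commute mult.assoc)
  then show ?thesis by (simp add: tscale_eq_mult)
qed

lemma tlinearI:
  assumes "\<And>s t. f (s + t) = f s + f t" "\<And>c t. f (tscale c t) = tscale c (f t)"
  shows "tlinear f"
  using assms by (simp add: Vector_Spaces.linear_iff tensor.vector_space_axioms)

lemma tlinear_mult_right: "tlinear (\<lambda>t. t * s)"
  by (rule tlinearI) (simp_all add: distrib_right tscale_mult_left)

lemma tlinear_mult_left: "tlinear (\<lambda>t. s * t)"
  by (rule tlinearI) (simp_all add: distrib_left tscale_mult_right)

lemma tlinear_comp: "tlinear f \<Longrightarrow> tlinear g \<Longrightarrow> tlinear (\<lambda>t. f (g t))"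
  by (simp add: Vector_Spaces.linear_iff)

lemma tlinear_add: "tlinear f \<Longrightarrow> tlinear g \<Longrightarrow> tlinear (\<lambda>t. f t + g t)"
  by (rule tensor_pair.linear_compose_add)

lemma tlinear_tscale: "tlinear f \<Longrightarrow> tlinear (\<lambda>t. tscale c (f t))"
  by (rule tensor_pair.linear_compose_scale_right)

lemma lin_ext_superset:
  assumes "finite A" "Poly_Mapping.keys t \<subseteq> A"
  shows "lin_ext f t = (\<Sum>w\<in>A. tscale (poly_mapping.lookup t w) (f w))"
  unfolding lin_ext_def
  by (rule sum.mono_neutral_left) (use assms in \<open>auto simp: in_keys_iff\<close>)

lemma lin_ext_add: "lin_ext f (s + t) = lin_ext f s + lin_ext f t"
proof -
  let ?A = "Poly_Mapping.keys s \<union> Poly_Mapping.keys t"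
  have "lin_ext f (s + t) = (\<Sum>w\<in>?A. tscale (poly_mapping.lookup (s + t) w) (f w))"
    by (rule lin_ext_superset) (auto simp: keys_add)
  also have "\<dots> = (\<Sum>w\<in>?A. tscale (poly_mapping.lookup s w) (f w)) +
      (\<Sum>w\<in>?A. tscale (poly_mapping.lookup t w) (f w))"
    by (simp add: lookup_add tensor.scale_left_distrib sum.distrib)
  also have "\<dots> = lin_ext f s + lin_ext f t"
    by (simp flip: lin_ext_superset[of ?A])
  finally show ?thesis .
qed

lemma lin_ext_tscale: "lin_ext f (tscale c t) = tscale c (lin_ext f t)"
proof -
  have "lin_ext f (tscale c t) =
      (\<Sum>w\<in>Poly_Mapping.keys t. tscale (poly_mapping.lookup (tscale c t) w) (f w))"
    by (rule lin_ext_superset) (auto simp: in_keys_iff)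
  then show ?thesis
    by (simp add: lin_ext_def tensor.scale_sum_right)
qed

lemma tlinear_lin_ext: "tlinear (lin_ext f)"
  by (rule tlinearI) (simp_all add: lin_ext_add lin_ext_tscale)

lemma lin_ext_word [simp]: "lin_ext f (word w) = f w"
  by (simp add: lin_ext_def)

lemma lin_ext_single [simp]: "lin_ext f (Poly_Mapping.single w c) = tscale c (f w)"
  by (subst single_eq_tscale_word) (simp only: lin_ext_tscale lin_ext_word)

lemma tensor_eq_sum_words:
  "t = (\<Sum>w\<in>Poly_Mapping.keys t. tscale (poly_mapping.lookup t w) (word w))"
  by (intro poly_mapping_eqI)
    (simp add: lookup_sum lookup_single when_def sum.delta' in_keys_iff)

lemma lin_ext_eq:
  assumes "tlinear f"
  shows "f t = lin_ext (\<lambda>w. f (word w)) t"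
proof -
  have "f (\<Sum>w\<in>Poly_Mapping.keys t. tscale (poly_mapping.lookup t w) (word w)) =
      (\<Sum>w\<in>Poly_Mapping.keys t. tscale (poly_mapping.lookup t w) (f (word w)))"
    using assms by (simp only: tensor_pair.linear_sum tensor_pair.linear_scale)
  then show ?thesis
    unfolding lin_ext_def by (simp only: flip: tensor_eq_sum_words)
qed

lemma lin_ext_cong:
  "(\<And>w. w \<in> Poly_Mapping.keys t \<Longrightarrow> f w = g w) \<Longrightarrow> lin_ext f t = lin_ext g t"
  by (simp add: lin_ext_def)

text \<open>Only words in the support of t have to be checked, so that a homogeneity hypothesis on t
  can be used in the comparison on words.\<close>

lemma tlinear_eqI:
  assumes "tlinear f" "tlinear g"
    and "\<And>w. w \<in> Poly_Mapping.keys t \<Longrightarrow> f (word w) = g (word w)"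
  shows "f t = g t"
proof -
  have "f t = lin_ext (\<lambda>w. f (word w)) t"
    by (rule lin_ext_eq) fact
  also have "\<dots> = lin_ext (\<lambda>w. g (word w)) t"
    by (rule lin_ext_cong) (rule assms(3))
  also have "\<dots> = g t"
    by (rule lin_ext_eq[symmetric]) fact
  finally show ?thesis .
qed

lemma keys_tscale_subset: "Poly_Mapping.keys (tscale c t) \<subseteq> Poly_Mapping.keys t"
  by (auto simp: in_keys_iff)

lemma keys_sum_subset: "Poly_Mapping.keys (sum f A) \<subseteq> (\<Union>a\<in>A. Poly_Mapping.keys (f a))"
proof
  fix w
  assume "w \<in> Poly_Mapping.keys (sum f A)"
  then have "(\<Sum>a\<in>A. poly_mapping.lookup (f a) w) \<noteq> 0"
    by (simp add: in_keys_iff lookup_sum)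
  then obtain a where "a \<in> A" "poly_mapping.lookup (f a) w \<noteq> 0"
    by (meson sum.neutral)
  then show "w \<in> (\<Union>a\<in>A. Poly_Mapping.keys (f a))"
    by (auto simp: in_keys_iff)
qed

lemma keys_lin_ext_subset:
  "Poly_Mapping.keys (lin_ext f t) \<subseteq> (\<Union>w\<in>Poly_Mapping.keys t. Poly_Mapping.keys (f w))"
  unfolding lin_ext_def using keys_sum_subset keys_tscale_subset by (fastforce simp: subset_iff)

section \<open>A recursive form of the quantum symmetrizers\<close>

text \<open>
  \<open>rins q j v\<close> and \<open>lins q i v\<close> braid a letter into all positions of the word \<open>v\<close>, starting from
  its right and from its left end. Up to these factors the quantum symmetrizer of degree \<open>m + 1\<close>
  is that of degree \<open>m\<close>, which makes the common kernel a two-sided ideal.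
\<close>

fun rins :: "('n \<Rightarrow> 'n \<Rightarrow> 'a :: field) \<Rightarrow> 'n \<Rightarrow> 'n list \<Rightarrow> ('n, 'a) tensor" where
  "rins q j [] = word [j]"
| "rins q j (y # v) =
     word [y] * rins q j v + Poly_Mapping.single (j # y # v) (\<Prod>z\<in>#mset (y # v). q z j)"

fun lins :: "('n \<Rightarrow> 'n \<Rightarrow> 'a :: field) \<Rightarrow> 'n \<Rightarrow> 'n list \<Rightarrow> ('n, 'a) tensor" where
  "lins q i [] = word [i]"
| "lins q i (y # v) = word (i # y # v) + tscale (q i y) (word [y] * lins q i v)"

text \<open>Inserting the letters one by one from the right mirrors the splitting of S_(m+1) into
  cosets of S_m. \<open>quantum_symmetrizer_word\<close> identifies the result with the symmetrizer
  on w.\<close>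

definition qsym :: "('n \<Rightarrow> 'n \<Rightarrow> 'a :: field) \<Rightarrow> 'n list \<Rightarrow> ('n, 'a) tensor" where
  "qsym q w = foldl (\<lambda>t j. lin_ext (rins q j) t) (word []) w"

lemma qsym_Nil: "qsym q [] = word []"
  by (simp add: qsym_def)

lemma qsym_snoc: "qsym q (w @ [j]) = lin_ext (rins q j) (qsym q w)"
  by (simp add: qsym_def)

text \<open>A multihomogeneous component of T(V). Multisets serve as degrees because the scalar
  gained by braiding a letter past a word depends only on the multiset of letters passed.\<close>

definition content :: "'n multiset \<Rightarrow> ('n, 'a :: field) tensor set" where
  "content M = {t. \<forall>w\<in>Poly_Mapping.keys t. mset w = M}"

lemma contentD: "t \<in> content M \<Longrightarrow> w \<in> Poly_Mapping.keys t \<Longrightarrow> mset w = M"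
  by (simp add: content_def)

lemma content_single: "mset w = M \<Longrightarrow> Poly_Mapping.single w c \<in> content M"
  by (simp add: content_def)

lemma content_add: "s \<in> content M \<Longrightarrow> t \<in> content M \<Longrightarrow> s + t \<in> content M"
  using keys_add[of s t] unfolding content_def by blast

lemma content_tscale: "t \<in> content M \<Longrightarrow> tscale c t \<in> content M"
  using keys_tscale_subset[of c t] unfolding content_def by blast

lemma content_mult: "s \<in> content M \<Longrightarrow> t \<in> content N \<Longrightarrow> s * t \<in> content (M + N)"
  using keys_mult[of s t] unfolding content_def by (fastforce simp: plus_list_def)

lemma content_word_mult: "t \<in> content M \<Longrightarrow> word [y] * t \<in> content (add_mset y M)"
  using content_mult[of "word [y]" "{#y#}" t M] by (simp add: content_single)

lemma content_lin_ext:
  assumes "\<And>w. mset w = M \<Longrightarrow> f w \<in> content N" "t \<in> content M"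
  shows "lin_ext f t \<in> content N"
  using keys_lin_ext_subset[of f t] assms unfolding content_def by blast

lemma content_rins: "rins q j v \<in> content (add_mset j (mset v))"
proof (induction v)
  case (Cons y v)
  then show ?case
    using content_word_mult[OF Cons, of y]
    by (auto intro!: content_add content_single simp: add_mset_commute)
qed (simp add: content_single)

lemma content_lins: "lins q j v \<in> content (add_mset j (mset v))"
proof (induction v)
  case (Cons y v)
  then show ?case
    using content_word_mult[OF Cons, of y]
    by (auto intro!: content_add content_single content_tscale simp: add_mset_commute)
qed (simp add: content_single)

lemma content_qsym: "qsym q w \<in> content (mset w)"
proof (induction w rule: rev_induct)
  case (snoc j w)
  then show ?case
    unfolding qsym_snoc
    by (auto intro!: content_lin_ext[of "mset w"]
        content_rins[THEN back_subst[of "\<lambda>M. _ \<in> content M"]])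
qed (simp add: qsym_Nil content_single)

text \<open>Linearizes the recursion of \<open>rins\<close>. The term in which j travels to the very
  front carries a factor depending on all letters passed, so t has to have a fixed content; for
  \<open>lins\<close> the recursion only involves the single factor \<open>q i y\<close>.\<close>

lemma lin_ext_rins_word_mult:
  assumes "t \<in> content M"
  shows "lin_ext (rins q j) (word [y] * t) = word [y] * lin_ext (rins q j) t +
    tscale (\<Prod>z\<in>#add_mset y M. q z j) (word [j] * (word [y] * t))"
proof (rule tlinear_eqI[of "\<lambda>t. lin_ext (rins q j) (word [y] * t)"
      "\<lambda>t. word [y] * lin_ext (rins q j) t +
        tscale (\<Prod>z\<in>#add_mset y M. q z j) (word [j] * (word [y] * t))"])
  fix w assume "w \<in> Poly_Mapping.keys t"
  then have "mset w = M" using assms by (simp add: contentD)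
  then show "lin_ext (rins q j) (word [y] * word w) = word [y] * lin_ext (rins q j) (word w) +
        tscale (\<Prod>z\<in>#add_mset y M. q z j) (word [j] * (word [y] * word w))"
    by (auto simp: single_times_single)
next
  show "tlinear (\<lambda>t. lin_ext (rins q j) (word [y] * t))"
    by (rule tlinear_comp[OF tlinear_lin_ext tlinear_mult_left])
  show "tlinear (\<lambda>t. word [y] * lin_ext (rins q j) t +
        tscale (\<Prod>z\<in>#add_mset y M. q z j) (word [j] * (word [y] * t)))"
    by (intro tlinear_add tlinear_tscale tlinear_comp[OF tlinear_mult_left tlinear_lin_ext]
        tlinear_comp[OF tlinear_mult_left tlinear_mult_left])
qed

lemma lin_ext_lins_word_mult:
  "lin_ext (lins q i) (word [y] * t) =
    word [i] * (word [y] * t) + tscale (q i y) (word [y] * lin_ext (lins q i) t)"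
proof -
  have l: "tlinear (\<lambda>t. lin_ext (lins q i) (word [y] * t))"
    by (rule tlinear_comp[OF tlinear_lin_ext tlinear_mult_left])
  have r: "tlinear (\<lambda>t. word [i] * (word [y] * t) + tscale (q i y) (word [y] * lin_ext (lins q i) t))"
    by (intro tlinear_add tlinear_tscale tlinear_comp[OF tlinear_mult_left tlinear_mult_left]
        tlinear_comp[OF tlinear_mult_left tlinear_lin_ext])
  show ?thesis
    by (rule tlinear_eqI[OF l r]) (simp add: single_times_single)
qed

text \<open>A letter i coming from the left and a letter j coming from the right cross at most once,
  and the crossing contributes \<open>q i j\<close> whichever of them is inserted first.\<close>

lemma rins_lins_commute: "lin_ext (rins q j) (lins q i v) = lin_ext (lins q i) (rins q j v)"
proof (induction v)
  case Nil
  show ?case by (simp add: single_times_single add.commute)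
next
  case (Cons y v)
  define Q where "Q = (\<Prod>z\<in>#mset (y # v). q z j)"
  have r: "rins q j (y # v) = word [y] * rins q j v + tscale Q (word (j # y # v))"
    by (simp add: Q_def)
  \<comment> \<open>The words in \<open>lins q i v\<close> contain i besides the letters of v, so a
    letter j moved to the front picks up \<open>q i j\<close> in addition to Q.\<close>
  have "lin_ext (rins q j) (lins q i (y # v)) =
      word [i] * rins q j (y # v) + tscale (q i j * Q) (word (j # i # y # v)) +
      tscale (q i y) (word [y] * lin_ext (rins q j) (lins q i v) +
        tscale (q i j * Q) (word [j] * (word [y] * lins q i v)))"
    using lin_ext_rins_word_mult[OF content_lins[of q i v], of q j y]
    by (simp add: lin_ext_add lin_ext_tscale Q_def mult.left_commute single_times_single)
  also have "\<dots> = lin_ext (lins q i) (rins q j (y # v))"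
    unfolding r
    by (simp add: lin_ext_add lin_ext_tscale lin_ext_lins_word_mult Cons.IH single_times_single
        distrib_left tensor.scale_right_distrib tscale_mult_right[symmetric] mult_ac)
  finally show ?case .
qed

text \<open>Insertions at the two ends commute, so the first letter may as well be inserted last.
  This second recursion makes the kernel closed under left multiplication.\<close>

lemma qsym_Cons: "qsym q (i # w) = lin_ext (lins q i) (qsym q w)"
proof (induction w rule: rev_induct)
  case Nil
  show ?case using qsym_snoc[of q "[]" i] by (simp add: qsym_Nil)
next
  case (snoc j w)
  have "qsym q (i # w @ [j]) = lin_ext (rins q j) (lin_ext (lins q i) (qsym q w))"
    using qsym_snoc[of q "i # w" j] snoc by simp
  also have "\<dots> = lin_ext (lins q i) (lin_ext (rins q j) (qsym q w))"
    by (rule tlinear_eqI[of "\<lambda>t. lin_ext (rins q j) (lin_ext (lins q i) t)"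
          "\<lambda>t. lin_ext (lins q i) (lin_ext (rins q j) t)"])
      (auto intro: tlinear_comp[OF tlinear_lin_ext tlinear_lin_ext] simp: rins_lins_commute)
  finally show ?case by (simp add: qsym_snoc)
qed

section \<open>Powers of a single letter and q-factorials\<close>

lemma rins_replicate:
  "rins q i (replicate m i) = Poly_Mapping.single (replicate (Suc m) i) (\<Sum>k\<le>m. q i i ^ k)"
proof (induction m)
  case (Suc m)
  have "rins q i (replicate (Suc m) i) =
      Poly_Mapping.single (replicate (Suc (Suc m)) i) (\<Sum>k\<le>m. q i i ^ k) +
      Poly_Mapping.single (replicate (Suc (Suc m)) i) (q i i ^ Suc m)"
    using Suc by (simp add: single_times_single)
  then show ?case by (simp flip: single_add)
qed simp

text \<open>All m + 1 positions for a further x_i give the same word, weighted by q_ii^k when k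
  letters are passed. The accumulated scalar is the q_ii-factorial of m.\<close>

lemma qsym_replicate:
  "qsym q (replicate m i) = Poly_Mapping.single (replicate m i) (\<Prod>l<m. \<Sum>k\<le>l. q i i ^ k)"
proof (induction m)
  case (Suc m)
  have "qsym q (replicate (Suc m) i) = lin_ext (rins q i) (qsym q (replicate m i))"
    by (metis qsym_snoc replicate_append_same replicate_Suc)
  with Suc show ?case by (simp add: rins_replicate)
qed (simp add: qsym_Nil)

definition qsym_kernel :: "('n \<Rightarrow> 'n \<Rightarrow> 'a :: field) \<Rightarrow> ('n, 'a) tensor set" where
  "qsym_kernel q = {t. lin_ext (qsym q) t = 0}"

text \<open>Prepending a letter before symmetrizing equals a linear insertion afterwards, so zero
  stays zero. For multiplication on the right, \<open>qsym_snoc\<close> replaces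
  \<open>qsym_Cons\<close>.\<close>

lemma qsym_kernel_word_left:
  assumes "t \<in> qsym_kernel q"
  shows "word w * t \<in> qsym_kernel q"
proof (induction w)
  case Nil
  then show ?case using assms by (simp add: word_Nil)
next
  case (Cons i w)
  have "lin_ext (qsym q) (word [i] * s) = lin_ext (lins q i) (lin_ext (qsym q) s)" for s
    by (rule tlinear_eqI[of "\<lambda>s. lin_ext (qsym q) (word [i] * s)"
          "\<lambda>s. lin_ext (lins q i) (lin_ext (qsym q) s)"])
      (auto intro: tlinear_comp[OF tlinear_lin_ext tlinear_lin_ext]
        tlinear_comp[OF tlinear_lin_ext tlinear_mult_left] simp: qsym_Cons single_times_single)
  from this[of "word w * t"] Cons show ?case
    by (simp add: qsym_kernel_def single_times_single tensor_pair.linear_0[OF tlinear_lin_ext]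
        flip: mult.assoc)
qed

lemma qsym_kernel_word_right:
  assumes "t \<in> qsym_kernel q"
  shows "t * word w \<in> qsym_kernel q"
proof (induction w rule: rev_induct)
  case Nil
  then show ?case using assms by (simp add: word_Nil)
next
  case (snoc i w)
  have "lin_ext (qsym q) (s * word [i]) = lin_ext (rins q i) (lin_ext (qsym q) s)" for s
    by (rule tlinear_eqI[of "\<lambda>s. lin_ext (qsym q) (s * word [i])"
          "\<lambda>s. lin_ext (rins q i) (lin_ext (qsym q) s)"])
      (auto intro: tlinear_comp[OF tlinear_lin_ext tlinear_lin_ext]
        tlinear_comp[OF tlinear_lin_ext tlinear_mult_right] simp: qsym_snoc single_times_single)
  from this[of "t * word w"] snoc show ?case
    by (simp add: qsym_kernel_def single_times_single tensor_pair.linear_0[OF tlinear_lin_ext]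
        mult.assoc)
qed

text \<open>Rescales each multihomogeneous component. An indicator of the size gives the projection
  to a tensor power, and values of the bicharacter give the factor in the bracket with a
  word.\<close>

definition diagonal :: "('n multiset \<Rightarrow> 'a) \<Rightarrow> ('n, 'a :: field) tensor \<Rightarrow> ('n, 'a) tensor" where
  "diagonal \<phi> = lin_ext (\<lambda>w. Poly_Mapping.single w (\<phi> (mset w)))"

lemma diagonal_content:
  assumes "t \<in> content M"
  shows "diagonal \<phi> t = tscale (\<phi> M) t"
  unfolding diagonal_def
proof (rule tlinear_eqI[of _ "tscale (\<phi> M)"])
  show "tlinear (tscale (\<phi> M))"
    by (rule tlinearI) (simp_all add: tensor.scale_right_distrib mult.commute)
qed (use assms in \<open>auto simp: contentD tlinear_lin_ext\<close>)

text \<open>Since \<open>qsym\<close> preserves the content, symmetrization commutes with every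
  \<open>diagonal\<close>; this is how the kernel is seen to be multigraded.\<close>

lemma qsym_kernel_diagonal:
  assumes "t \<in> qsym_kernel q"
  shows "diagonal \<phi> t \<in> qsym_kernel q"
proof -
  have "lin_ext (qsym q) (diagonal \<phi> s) = diagonal \<phi> (lin_ext (qsym q) s)" for s
  proof (rule tlinear_eqI[of "\<lambda>s. lin_ext (qsym q) (diagonal \<phi> s)"
        "\<lambda>s. diagonal \<phi> (lin_ext (qsym q) s)"])
    fix w :: "'a list"
    show "lin_ext (qsym q) (diagonal \<phi> (word w)) = diagonal \<phi> (lin_ext (qsym q) (word w))"
      by (simp add: diagonal_content[OF content_qsym]) (simp add: diagonal_def)
  qed (auto intro: tlinear_comp[OF tlinear_lin_ext tlinear_lin_ext] simp: diagonal_def)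
  with assms show ?thesis
    by (simp add: qsym_kernel_def diagonal_def tensor_pair.linear_0[OF tlinear_lin_ext])
qed

text \<open>Symmetrization leaves the constant term alone, as a nonempty word is sent to nonempty
  words. This is what separates the scalars from the braided Lie algebra.\<close>

lemma qsym_kernel_lookup_Nil:
  assumes "t \<in> qsym_kernel q"
  shows "poly_mapping.lookup t [] = 0"
proof -
  have "poly_mapping.lookup (qsym q w) [] = (if w = [] then 1 else 0)" for w
  proof (cases "w = []")
    case False
    then show ?thesis
      using contentD[OF content_qsym, of "[]" q w] by (auto simp: in_keys_iff)
  qed (simp add: qsym_Nil)
  then have "poly_mapping.lookup (lin_ext (qsym q) t) [] =
      (\<Sum>w\<in>Poly_Mapping.keys t. if w = [] then poly_mapping.lookup t w else 0)"
    unfolding lin_ext_def lookup_sum lookup_tscale by (intro sum.cong) auto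
  also have "\<dots> = poly_mapping.lookup t []"
    by (simp add: sum.delta' in_keys_iff)
  finally have "poly_mapping.lookup (lin_ext (qsym q) t) [] = poly_mapping.lookup t []" .
  with assms show ?thesis by (simp add: qsym_kernel_def)
qed

section \<open>Reduced expressions and inversions\<close>

text \<open>In the presence of HOL-Algebra the notation \<open>inv\<close> stands for inverses in a group.\<close>

abbreviation perm_inv :: "(nat \<Rightarrow> nat) \<Rightarrow> nat \<Rightarrow> nat" where
  "perm_inv \<equiv> inv_into UNIV"

definition inversions :: "nat \<Rightarrow> (nat \<Rightarrow> nat) \<Rightarrow> (nat \<times> nat) set" where
  "inversions m \<sigma> = {(x, y). x < y \<and> y < m \<and> \<sigma> y < \<sigma> x}"

lemma finite_inversions [simp]: "finite (inversions m \<sigma>)"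
  by (rule finite_subset[of _ "{..<m} \<times> {..<m}"]) (auto simp: inversions_def)

lemma simple_product_Nil [simp]: "simple_product [] = id"
  by (simp add: simple_product_def)

lemma simple_product_Cons [simp]:
  "simple_product (k # ks) = transpose k (Suc k) \<circ> simple_product ks"
  by (simp add: simple_product_def)

lemma simple_product_append [simp]:
  "simple_product (ks @ ls) = simple_product ks \<circ> simple_product ls"
  by (induction ks) (simp_all add: comp_assoc)

lemma simple_product_permutes:
  "\<forall>k\<in>set ks. Suc k < m \<Longrightarrow> simple_product ks permutes {..<m}"
proof (induction ks)
  case (Cons k ks)
  have "transpose k (Suc k) \<circ> simple_product ks permutes {..<m}"
    by (rule permutes_compose) (use Cons in \<open>auto intro: permutes_swap_id\<close>)
  then show ?case
    by (simp only: simple_product_Cons)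
qed (simp add: permutes_id)

text \<open>Multiplying by s_k on the left exchanges the values k and k + 1, so only the pair of
  positions carrying them changes its relative order. If that pair was in order, it becomes the one
  new inversion.\<close>

lemma inversions_transpose:
  assumes \<tau>: "\<tau> permutes {..<m}" and k: "Suc k < m" and less: "perm_inv \<tau> k < perm_inv \<tau> (Suc k)"
  shows "inversions m (transpose k (Suc k) \<circ> \<tau>) =
      insert (perm_inv \<tau> k, perm_inv \<tau> (Suc k)) (inversions m \<tau>)"
    and "(perm_inv \<tau> k, perm_inv \<tau> (Suc k)) \<notin> inversions m \<tau>"
proof -
  have iff: "\<tau> x = y \<longleftrightarrow> x = perm_inv \<tau> y" for x y
    using permutes_inverses[OF \<tau>] by metis
  have b: "perm_inv \<tau> (Suc k) < m"
    using permutes_in_image[OF permutes_inv[OF \<tau>], of "Suc k"] k by simp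
  have "(transpose k (Suc k) (\<tau> y) < transpose k (Suc k) (\<tau> x)) \<longleftrightarrow>
      \<tau> y < \<tau> x \<or> x = perm_inv \<tau> k \<and> y = perm_inv \<tau> (Suc k)" if "x < y" for x y
  proof -
    have "transpose k (Suc k) u < transpose k (Suc k) v \<longleftrightarrow> u < v \<or> v = k \<and> u = Suc k"
      if "\<not> (u = k \<and> v = Suc k)" for u v
      using that by (auto simp: transpose_def)
    moreover have "\<not> (\<tau> y = k \<and> \<tau> x = Suc k)"
      using that less unfolding iff by auto
    ultimately show ?thesis
      unfolding iff[symmetric] by blast
  qed
  with less b show "inversions m (transpose k (Suc k) \<circ> \<tau>) =
      insert (perm_inv \<tau> k, perm_inv \<tau> (Suc k)) (inversions m \<tau>)"
    by (auto simp: inversions_def)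
  show "(perm_inv \<tau> k, perm_inv \<tau> (Suc k)) \<notin> inversions m \<tau>"
    using permutes_inverses[OF \<tau>] by (simp add: inversions_def)
qed

text \<open>The fold from \<open>braid_lift\<close>, along an explicit expression instead of the
  chosen one.\<close>

definition braid_word ::
    "('n \<Rightarrow> 'n \<Rightarrow> 'a :: field) \<Rightarrow> nat list \<Rightarrow> ('n, 'a) tensor \<Rightarrow> ('n, 'a) tensor" where
  "braid_word q ks = foldr (\<lambda>k f. braid q k \<circ> f) ks id"

lemma braid_word_Nil [simp]: "braid_word q [] = id"
  by (simp add: braid_word_def)

lemma braid_word_Cons [simp]: "braid_word q (k # ks) = braid q k \<circ> braid_word q ks"
  by (simp add: braid_word_def)

lemma braid_word_append [simp]: "braid_word q (ks @ ls) = braid_word q ks \<circ> braid_word q ls"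
  by (induction ks) (simp_all add: comp_assoc)

lemma tlinear_braid_word: "tlinear (braid_word q ks)"
proof (induction ks)
  case Nil
  show ?case by (rule tlinearI) simp_all
next
  case (Cons k ks)
  then show ?case
    using tlinear_comp[OF tlinear_lin_ext Cons] by (simp add: braid_def comp_def)
qed

text \<open>
  The coefficient depends on the permutation only, so this replaces Matsumoto's theorem: all
  expressions with as many factors as inversions give the same operator.
\<close>

lemma braid_word_inversions:
  assumes "\<forall>k\<in>set ks. Suc k < length w"
  defines "\<tau> \<equiv> simple_product ks"
  shows "card (inversions (length w) \<tau>) \<le> length ks \<and>
    (card (inversions (length w) \<tau>) = length ks \<longrightarrow>
      braid_word q ks (word w) = Poly_Mapping.single (permute_list (perm_inv \<tau>) w)
        (\<Prod>(x, y)\<in>inversions (length w) \<tau>. q (w ! x) (w ! y)))"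
  using assms(1) unfolding \<tau>_def
proof (induction ks)
  case Nil
  have "inversions (length w) id = {}"
    by (auto simp: inversions_def)
  then show ?case by (simp add: id_def)
next
  case (Cons k ks)
  define \<tau> where "\<tau> = simple_product ks"
  define s where "s = transpose k (Suc k)"
  let ?m = "length w"
  have k: "Suc k < ?m" and \<tau>: "\<tau> permutes {..<?m}"
    using Cons.prems simple_product_permutes[of ks ?m] by (auto simp: \<tau>_def)
  have s: "s permutes {..<?m}"
    unfolding s_def using k by (intro permutes_swap_id) auto
  have s\<tau>: "s \<circ> \<tau> permutes {..<?m}"
    using \<tau> s by (rule permutes_compose)
  have inv_s\<tau>: "perm_inv (s \<circ> \<tau>) = perm_inv \<tau> \<circ> s"
    using \<tau> s by (simp add: o_inv_distrib permutes_bij s_def)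
  have product: "simple_product (k # ks) = s \<circ> \<tau>"
    unfolding s_def \<tau>_def by (rule simple_product_Cons)
  have IH: "card (inversions ?m \<tau>) \<le> length ks"
    "card (inversions ?m \<tau>) = length ks \<Longrightarrow>
      braid_word q ks (word w) = Poly_Mapping.single (permute_list (perm_inv \<tau>) w)
        (\<Prod>(x, y)\<in>inversions ?m \<tau>. q (w ! x) (w ! y))"
    using Cons by (auto simp: \<tau>_def)
  consider "perm_inv \<tau> k < perm_inv \<tau> (Suc k)" | "perm_inv \<tau> (Suc k) < perm_inv \<tau> k"
    using permutes_inj[OF permutes_inv[OF \<tau>]] by (metis inj_eq linorder_neqE_nat n_not_Suc_n)
  then show ?case
  proof cases
    case 1
    note ins = inversions_transpose[OF \<tau> k 1, folded s_def]
    let ?v = "permute_list (perm_inv \<tau>) w"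
    \<comment> \<open>After the crossings in ks, position k holds the letter that started at
      \<open>perm_inv \<tau> k\<close>, so the next crossing contributes exactly the factor of the
      new inversion.\<close>
    have v: "?v ! k = w ! perm_inv \<tau> k" "?v ! Suc k = w ! perm_inv \<tau> (Suc k)"
      using k permutes_inv[OF \<tau>] by (simp_all add: permute_list_nth)
    have swap: "?v[k := ?v ! Suc k, Suc k := ?v ! k] = permute_list (perm_inv (s \<circ> \<tau>)) w"
    proof (rule nth_equalityI)
      fix i assume "i < length (?v[k := ?v ! Suc k, Suc k := ?v ! k])"
      then show "?v[k := ?v ! Suc k, Suc k := ?v ! k] ! i = permute_list (perm_inv (s \<circ> \<tau>)) w ! i"
        using k permutes_inv[OF \<tau>] permutes_inv[OF s\<tau>]
        by (auto simp: permute_list_nth nth_list_update inv_s\<tau>[unfolded s_def] s_def)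
    qed simp
    have "braid_word q (k # ks) (word w) = Poly_Mapping.single (permute_list (perm_inv (s \<circ> \<tau>)) w)
        (\<Prod>(x, y)\<in>inversions ?m (s \<circ> \<tau>). q (w ! x) (w ! y))"
      if "card (inversions ?m (s \<circ> \<tau>)) = Suc (length ks)"
    proof -
      have "card (inversions ?m \<tau>) = length ks"
        using that ins by simp
      from IH(2)[OF this] show ?thesis
        using ins by (simp add: braid_def swap[unfolded v] v mult.commute)
    qed
    moreover have "card (inversions ?m (s \<circ> \<tau>)) \<le> Suc (length ks)"
      using IH ins by simp
    ultimately show ?thesis
      by (simp only: product length_Cons) blast
  next
    case 2
    \<comment> \<open>Here s removes an inversion: the previous lemma, applied to
      \<open>s \<circ> \<tau>\<close>, recovers \<tau> with one inversion more. The expression is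
      then longer than its inversion number, and the claim about the operator is vacuous.\<close>
    have "s \<circ> (s \<circ> \<tau>) = \<tau>"
      by (simp add: s_def flip: comp_assoc)
    with inversions_transpose[OF s\<tau> k, folded s_def] 2
    have "card (inversions ?m \<tau>) = Suc (card (inversions ?m (s \<circ> \<tau>)))"
      by (simp add: inv_s\<tau>) (simp add: s_def)
    with IH(1) have "card (inversions ?m (s \<circ> \<tau>)) < Suc (length ks)"
      by linarith
    then show ?thesis
      by (simp only: product length_Cons less_imp_le less_imp_neq) simp
  qed
qed

section \<open>Coset decomposition of the symmetric group and minimal expressions\<close>

lemma simple_product_upt:
  assumes "p \<le> m"
  shows "simple_product [p..<m] x =
    (if x < p then x else if x < m then Suc x else if x = m then p else x)"
  using assms
proof (induction arbitrary: x rule: inc_induct)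
  case base
  then show ?case by simp
next
  case (step p)
  then show ?case by (auto simp: upt_conv_Cons transpose_def)
qed

text \<open>The cycle is increasing on values below m, so the inversions of \<tau> survive. Position
  m receives the value p and is inverted with the m - p positions whose value under \<tau> is at
  least p. Hence lengths add, and minimal expressions can be concatenated.\<close>

lemma inversions_cycle:
  assumes \<tau>: "\<tau> permutes {..<m}" and p: "p \<le> m"
  shows "card (inversions (Suc m) (simple_product [p..<m] \<circ> \<tau>)) = m - p + card (inversions m \<tau>)"
proof -
  let ?X = "{x. x < m \<and> p \<le> \<tau> x}"
  have lt: "\<tau> x < m \<longleftrightarrow> x < m" for x
    using permutes_in_image[OF \<tau>, of x] by simp
  have m: "\<tau> m = m"
    using \<tau> by (simp add: permutes_not_in)
  let ?c = "simple_product [p..<m]"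
  have iff: "(x, y) \<in> inversions (Suc m) (?c \<circ> \<tau>) \<longleftrightarrow>
      (x, y) \<in> (\<lambda>x. (x, m)) ` ?X \<union> inversions m \<tau>" for x y
  proof -
    consider "x < y" "y < m" | "x < y" "y = m" | "\<not> x < y \<or> \<not> y < Suc m"
      by linarith
    then show "(x, y) \<in> inversions (Suc m) (?c \<circ> \<tau>) \<longleftrightarrow>
        (x, y) \<in> (\<lambda>x. (x, m)) ` ?X \<union> inversions m \<tau>"
    proof cases
      case 1
      then have "\<tau> x < m" "\<tau> y < m"
        by (simp_all only: lt)
      then have "?c (\<tau> y) < ?c (\<tau> x) \<longleftrightarrow> \<tau> y < \<tau> x"
        by (auto simp: simple_product_upt[OF p])
      with 1 show ?thesis
        by (auto simp: inversions_def)
    next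
      case 2
      then have "\<tau> x < m"
        by (simp only: lt)
      with 2 show ?thesis
        by (auto simp: inversions_def simple_product_upt[OF p] m)
    next
      case 3
      then show ?thesis
        by (auto simp: inversions_def)
    qed
  qed
  have "inversions (Suc m) (?c \<circ> \<tau>) = (\<lambda>x. (x, m)) ` ?X \<union> inversions m \<tau>"
    by (intro equalityI subrelI) (simp_all only: iff)
  moreover have "(\<lambda>x. (x, m)) ` ?X \<inter> inversions m \<tau> = {}"
    by (auto simp: inversions_def)
  moreover have "card ((\<lambda>x. (x, m)) ` ?X) = card ?X"
    by (intro card_image) (auto simp: inj_on_def)
  moreover have "\<tau> ` ?X = {p..<m}"
  proof
    show "{p..<m} \<subseteq> \<tau> ` ?X"
    proof
      fix y assume "y \<in> {p..<m}"
      moreover have y: "\<tau> (perm_inv \<tau> y) = y"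
        by (rule permutes_inverses(1)[OF \<tau>])
      ultimately have "perm_inv \<tau> y \<in> ?X"
        using lt[of "perm_inv \<tau> y"] by simp
      then have "\<tau> (perm_inv \<tau> y) \<in> \<tau> ` ?X"
        by (rule imageI)
      then show "y \<in> \<tau> ` ?X"
        by (simp only: y)
    qed
    show "\<tau> ` ?X \<subseteq> {p..<m}"
    proof
      fix y assume "y \<in> \<tau> ` ?X"
      then obtain x where "y = \<tau> x" "x < m" "p \<le> \<tau> x"
        by blast
      with lt[of x] show "y \<in> {p..<m}"
        by simp
    qed
  qed
  then have "card ?X = m - p"
    using card_image[of \<tau> ?X] permutes_inj_on[OF \<tau>] by (metis card_atLeastLessThan)
  ultimately show ?thesis
    by (simp add: card_Un_disjoint)
qed

text \<open>The image of m determines p, and dividing by the cycle for p leaves a permutation fixing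
  m. This turns a sum over S_(m+1) into a double sum.\<close>

lemma permutes_lessThan_Suc:
  "bij_betw (\<lambda>(p, \<tau>). simple_product [p..<m] \<circ> \<tau>)
    ({..m} \<times> {\<tau>. \<tau> permutes {..<m}}) {\<sigma>. \<sigma> permutes {..<Suc m}}"
proof -
  let ?c = "\<lambda>p. simple_product [p..<m]"
  have c: "?c p permutes {..<Suc m}" for p
    by (rule simple_product_permutes) auto
  have m: "(?c p \<circ> \<tau>) m = p" if "p \<le> m" "\<tau> permutes {..<m}" for p \<tau>
    using that by (simp add: simple_product_upt permutes_not_in)
  show ?thesis
  proof (rule bij_betwI')
    fix x y
    assume "x \<in> {..m} \<times> {\<tau>. \<tau> permutes {..<m}}" "y \<in> {..m} \<times> {\<tau>. \<tau> permutes {..<m}}"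
    then obtain p \<tau> p' \<tau>' where x: "x = (p, \<tau>)" "p \<le> m" "\<tau> permutes {..<m}"
      and y: "y = (p', \<tau>')" "p' \<le> m" "\<tau>' permutes {..<m}"
      by auto
    show "((case x of (p, \<tau>) \<Rightarrow> ?c p \<circ> \<tau>) = (case y of (p, \<tau>) \<Rightarrow> ?c p \<circ> \<tau>)) = (x = y)"
    proof
      assume "(case x of (p, \<tau>) \<Rightarrow> ?c p \<circ> \<tau>) = (case y of (p, \<tau>) \<Rightarrow> ?c p \<circ> \<tau>)"
      then have eq: "?c p \<circ> \<tau> = ?c p' \<circ> \<tau>'"
        using x y by simp
      then have "p = p'"
        using m[OF x(2,3)] m[OF y(2,3)] by simp
      with eq have "\<tau> = \<tau>'"
        by (auto simp: fun_eq_iff inj_eq[OF permutes_inj[OF c]])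
      with \<open>p = p'\<close> show "x = y"
        using x y by simp
    qed simp
  next
    fix x assume "x \<in> {..m} \<times> {\<tau>. \<tau> permutes {..<m}}"
    then show "(case x of (p, \<tau>) \<Rightarrow> ?c p \<circ> \<tau>) \<in> {\<sigma>. \<sigma> permutes {..<Suc m}}"
      using permutes_compose[OF _ c] permutes_subset[of _ "{..<m}" "{..<Suc m}"] by auto
  next
    fix \<sigma> assume "\<sigma> \<in> {\<sigma>. \<sigma> permutes {..<Suc m}}"
    then have \<sigma>: "\<sigma> permutes {..<Suc m}" by simp
    let ?p = "\<sigma> m"
    let ?\<tau> = "perm_inv (?c ?p) \<circ> \<sigma>"
    have p: "?p \<le> m"
      using permutes_in_image[OF \<sigma>, of m] by simp
    have \<sigma>_eq: "\<sigma> = ?c ?p \<circ> ?\<tau>"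
      using permutes_inverses[OF c] by (simp add: fun_eq_iff)
    have "?\<tau> permutes {..<Suc m}"
      using \<sigma> permutes_inv[OF c] by (rule permutes_compose)
    moreover have "?\<tau> m = m"
      using permutes_inverses(2)[OF c, of ?p m] p by (simp add: simple_product_upt)
    moreover have "\<rho> permutes {..<m}" if "\<rho> permutes {..<Suc m}" "\<rho> m = m" for \<rho>
      using that by (auto intro: permutes_superset simp: less_Suc_eq)
    ultimately have "?\<tau> permutes {..<m}"
      by blast
    with p \<sigma>_eq show "\<exists>x\<in>{..m} \<times> {\<tau>. \<tau> permutes {..<m}}. \<sigma> = (case x of (p, \<tau>) \<Rightarrow> ?c p \<circ> \<tau>)"
      by auto
  qed
qed

text \<open>Concatenating the cycles of the successive coset decompositions attains the lower bound
  for the length in \<open>braid_word_inversions\<close>.\<close>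

lemma obtain_inversions_expression:
  assumes "\<sigma> permutes {..<m}"
  obtains ks where "\<forall>k\<in>set ks. Suc k < m" "simple_product ks = \<sigma>"
    "length ks = card (inversions m \<sigma>)"
  using assms
proof (induction m arbitrary: \<sigma> thesis)
  case 0
  from 0(2) have "\<sigma> = id" by simp
  then show ?case
    using 0(1)[of "[]"] by (simp add: inversions_def)
next
  case (Suc m)
  have "\<sigma> \<in> (\<lambda>(p, \<tau>). simple_product [p..<m] \<circ> \<tau>) ` ({..m} \<times> {\<tau>. \<tau> permutes {..<m}})"
    using Suc.prems(2) bij_betw_imp_surj_on[OF permutes_lessThan_Suc[of m]] by simp
  then obtain p \<tau> where p: "p \<le> m" and \<tau>: "\<tau> permutes {..<m}"
    and \<sigma>: "\<sigma> = simple_product [p..<m] \<circ> \<tau>"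
    by (auto simp del: o_apply)
  obtain ks where ks: "\<forall>k\<in>set ks. Suc k < m" "simple_product ks = \<tau>"
    "length ks = card (inversions m \<tau>)"
    using Suc.IH[OF _ \<tau>] by blast
  show ?case
  proof (rule Suc.prems(1))
    show "\<forall>k\<in>set ([p..<m] @ ks). Suc k < Suc m"
      using ks by auto
    show "simple_product ([p..<m] @ ks) = \<sigma>"
      using ks \<sigma> by simp
    show "length ([p..<m] @ ks) = card (inversions (Suc m) \<sigma>)"
      using ks \<sigma> inversions_cycle[OF \<tau> p] by simp
  qed
qed

text \<open>Eliminates the choice of a reduced expression: ks attains the minimal length, so the
  chosen expression also has as many factors as there are inversions, and both yield the same scalar
  multiple of the same word.\<close>

lemma braid_lift_word:
  assumes "\<forall>k\<in>set ks. Suc k < length w" "simple_product ks = \<sigma>"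
    "length ks = card (inversions (length w) \<sigma>)"
  shows "braid_lift q (length w) \<sigma> (word w) = braid_word q ks (word w)"
proof -
  let ?m = "length w"
  define ls where "ls = (SOME ls. reduced_expression ?m \<sigma> ls)"
  have "length ks \<le> length ls" if "\<forall>k\<in>set ls. Suc k < ?m" "simple_product ls = \<sigma>" for ls
    using braid_word_inversions[of ls w q] that assms(3) by simp
  then have "reduced_expression ?m \<sigma> ks"
    using assms by (simp add: reduced_expression_def)
  then have "reduced_expression ?m \<sigma> ls"
    unfolding ls_def by (rule someI)
  then have ls: "\<forall>k\<in>set ls. Suc k < ?m" "simple_product ls = \<sigma>" "length ls \<le> length ks"
    using assms by (auto simp: reduced_expression_def)
  then have "card (inversions ?m \<sigma>) = length ls"
    using assms braid_word_inversions[of ls w q] by simp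
  then have "braid_word q ls (word w) = Poly_Mapping.single (permute_list (perm_inv \<sigma>) w)
      (\<Prod>(x, y)\<in>inversions ?m \<sigma>. q (w ! x) (w ! y))"
    using braid_word_inversions[of ls w q] ls by simp
  also have "\<dots> = braid_word q ks (word w)"
    using braid_word_inversions[of ks w q] assms by simp
  finally have "braid_word q ls (word w) = braid_word q ks (word w)" .
  then show ?thesis
    by (simp add: braid_lift_def braid_word_def ls_def)
qed

lemma braid_word_append_word:
  assumes "\<forall>k\<in>set ks. Suc k < length w"
  shows "braid_word q ks (word (w @ u)) = braid_word q ks (word w) * word u"
proof -
  \<comment> \<open>The induction has to carry along that the intermediate result is a multiple of
    one word as long as w, so that the next braiding still acts to the left of u.\<close>
  have "\<exists>v c. length v = length w \<and> braid_word q ks (word w) = Poly_Mapping.single v c \<and>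
      braid_word q ks (word (w @ u)) = Poly_Mapping.single (v @ u) c"
    using assms
  proof (induction ks)
    case (Cons k ks)
    then obtain v c where "length v = length w" "braid_word q ks (word w) = Poly_Mapping.single v c"
      "braid_word q ks (word (w @ u)) = Poly_Mapping.single (v @ u) c"
      by auto
    then show ?case
      using Cons.prems by (intro exI[of _ "v[k := v ! Suc k, Suc k := v ! k]"]
          exI[of _ "c * q (v ! k) (v ! Suc k)"])
        (simp add: braid_def nth_append list_update_append)
  qed auto
  then show ?thesis
    by (auto simp: single_times_single)
qed

text \<open>The last entry of the list acts first, so j starts at the right end and travels left
  until position p, gaining \<open>q z j\<close> from each letter z it passes.\<close>

lemma braid_word_upt:
  assumes "p \<le> length v"
  shows "braid_word q [p..<length v] (word (v @ [j])) =
    Poly_Mapping.single (take p v @ j # drop p v) (\<Prod>z\<in>#mset (drop p v). q z j)"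
  using assms
proof (induction rule: inc_induct)
  case (step p)
  let ?w = "take (Suc p) v @ j # drop (Suc p) v"
  have "?w ! p = v ! p" "?w ! Suc p = j"
    using step by (auto simp: nth_append)
  moreover have "?w = take p v @ v ! p # j # drop (Suc p) v"
    using step by (simp add: take_Suc_conv_app_nth)
  then have "?w[p := j, Suc p := v ! p] = take p v @ j # drop p v"
    using step by (simp add: list_update_append Cons_nth_drop_Suc)
  ultimately show ?case
    using step by (simp add: upt_conv_Cons braid_def mult.commute flip: Cons_nth_drop_Suc)
qed simp

lemma rins_eq_sum:
  "rins q j v = (\<Sum>p\<le>length v.
    Poly_Mapping.single (take p v @ j # drop p v) (\<Prod>z\<in>#mset (drop p v). q z j))"
proof (induction v)
  case (Cons y v)
  have "rins q j (y # v) = (\<Sum>p\<le>length v. word [y] *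
      Poly_Mapping.single (take p v @ j # drop p v) (\<Prod>z\<in>#mset (drop p v). q z j)) +
      Poly_Mapping.single (j # y # v) (\<Prod>z\<in>#mset (y # v). q z j)"
    using Cons by (simp add: sum_distrib_left)
  then show ?case
    by (simp add: single_times_single sum.atMost_Suc_shift add.commute del: sum.atMost_Suc)
qed simp

lemma tlinear_sum: "(\<And>a. a \<in> A \<Longrightarrow> tlinear (f a)) \<Longrightarrow> tlinear (\<lambda>t. \<Sum>a\<in>A. f a t)"
  by (rule tensor_pair.linear_compose_sum) blast

lemma lin_ext_rins_eq_sum:
  assumes "t \<in> tensor_power m"
  shows "lin_ext (rins q j) t = (\<Sum>p\<le>m. braid_word q [p..<m] (t * word [j]))"
proof (rule tlinear_eqI[of "lin_ext (rins q j)" "\<lambda>t. \<Sum>p\<le>m. braid_word q [p..<m] (t * word [j])"])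
  fix w assume "w \<in> Poly_Mapping.keys t"
  then have "m = length w"
    using assms by (simp add: tensor_power_def)
  then show "lin_ext (rins q j) (word w) = (\<Sum>p\<le>m. braid_word q [p..<m] (word w * word [j]))"
    by (simp add: single_times_single rins_eq_sum braid_word_upt)
next
  show "tlinear (\<lambda>t. \<Sum>p\<le>m. braid_word q [p..<m] (t * word [j]))"
    by (intro tlinear_sum tlinear_comp[OF tlinear_braid_word tlinear_mult_right])
qed (rule tlinear_lin_ext)

lemma qsym_tensor_power: "qsym q w \<in> tensor_power (length w)"
  using contentD[OF content_qsym[of q w]] unfolding tensor_power_def
  by (auto dest: mset_eq_length)

text \<open>In each coset, \<tau> acts on the first m letters and the cycle then carries the last
  letter to position p. The sum over \<tau> is the symmetrizer of degree m, and the sum over p is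
  the insertion \<open>rins\<close>.\<close>

lemma quantum_symmetrizer_word: "quantum_symmetrizer q (length w) (word w) = qsym q w"
proof (induction w rule: rev_induct)
  case Nil
  have "braid_lift q 0 id (word []) = word []"
    using braid_lift_word[of "[]" "[]" id q] by (simp add: inversions_def)
  then show ?case
    by (simp add: quantum_symmetrizer_def qsym_Nil)
next
  case (snoc j w)
  let ?m = "length w"
  \<comment> \<open>Because lengths add, the concatenated expression is one to which
    \<open>braid_lift_word\<close> applies.\<close>
  have lift: "braid_lift q (Suc ?m) (simple_product [p..<?m] \<circ> \<tau>) (word (w @ [j])) =
      braid_word q [p..<?m] (braid_lift q ?m \<tau> (word w) * word [j])"
    if p: "p \<le> ?m" and \<tau>: "\<tau> permutes {..<?m}" for p \<tau>
  proof -
    obtain ks where ks: "\<forall>k\<in>set ks. Suc k < ?m" "simple_product ks = \<tau>"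
      "length ks = card (inversions ?m \<tau>)"
      using obtain_inversions_expression[OF \<tau>] by blast
    have "braid_lift q (length (w @ [j])) (simple_product [p..<?m] \<circ> \<tau>) (word (w @ [j])) =
        braid_word q ([p..<?m] @ ks) (word (w @ [j]))"
      using ks by (intro braid_lift_word) (auto simp: inversions_cycle[OF \<tau> p])
    then show ?thesis
      using ks by (simp add: braid_word_append_word braid_lift_word)
  qed
  have "quantum_symmetrizer q (Suc ?m) (word (w @ [j])) =
      (\<Sum>(p, \<tau>)\<in>{..?m} \<times> {\<tau>. \<tau> permutes {..<?m}}.
        braid_lift q (Suc ?m) (simple_product [p..<?m] \<circ> \<tau>) (word (w @ [j])))"
    unfolding quantum_symmetrizer_def
    by (subst sum.reindex_bij_betw[OF permutes_lessThan_Suc, symmetric]) (simp add: case_prod_unfold)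
  also have "\<dots> = (\<Sum>p\<le>?m. \<Sum>\<tau> | \<tau> permutes {..<?m}.
      braid_word q [p..<?m] (braid_lift q ?m \<tau> (word w) * word [j]))"
    by (subst sum.cartesian_product[symmetric]) (simp add: lift)
  also have "\<dots> = (\<Sum>p\<le>?m. braid_word q [p..<?m] (qsym q w * word [j]))"
    unfolding snoc[symmetric] quantum_symmetrizer_def sum_distrib_right
    by (simp add: tensor_pair.linear_sum[OF tlinear_braid_word])
  also have "\<dots> = qsym q (w @ [j])"
    by (simp add: lin_ext_rins_eq_sum[OF qsym_tensor_power] qsym_snoc)
  finally show ?case by simp
qed

lemma quantum_symmetrizer_eq_qsym:
  assumes "t \<in> tensor_power m"
  shows "quantum_symmetrizer q m t = lin_ext (qsym q) t"
proof (rule tlinear_eqI[of "quantum_symmetrizer q m"])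
  show "tlinear (quantum_symmetrizer q m)"
    using tlinear_braid_word[of q]
    unfolding quantum_symmetrizer_def[abs_def] braid_lift_def braid_word_def
    by (intro tlinear_sum) blast
qed (use assms in \<open>auto simp: tensor_power_def quantum_symmetrizer_word tlinear_lin_ext\<close>)

section \<open>The Nichols algebra as a quotient by a graded ideal\<close>

lemma qsym_kernel_subspace: "tensor.subspace (qsym_kernel q)"
  by (rule tensor.subspaceI)
    (simp_all add: qsym_kernel_def lin_ext_add lin_ext_tscale tensor_pair.linear_0[OF tlinear_lin_ext])

lemma lin_ext_in_subspace:
  assumes "tensor.subspace S" "\<And>w. w \<in> Poly_Mapping.keys t \<Longrightarrow> f w \<in> S"
  shows "lin_ext f t \<in> S"
  unfolding lin_ext_def using assms by (intro tensor.subspace_sum tensor.subspace_scale)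

lemma lookup_diagonal: "poly_mapping.lookup (diagonal \<phi> t) w = \<phi> (mset w) * poly_mapping.lookup t w"
proof -
  have "poly_mapping.lookup (diagonal \<phi> t) w =
      (\<Sum>v\<in>Poly_Mapping.keys t. if v = w then \<phi> (mset w) * poly_mapping.lookup t w else 0)"
    unfolding diagonal_def lin_ext_def lookup_sum lookup_tscale
    by (intro sum.cong) (auto simp: lookup_single when_def)
  then show ?thesis
    by (simp add: sum.delta' in_keys_iff)
qed

lemma nichols_ideal_eq_kernel: "nichols_ideal q = qsym_kernel q"
proof
  show "nichols_ideal q \<subseteq> qsym_kernel q"
    unfolding nichols_ideal_def
    by (rule tensor.span_minimal[OF _ qsym_kernel_subspace])
      (auto simp: qsym_kernel_def quantum_symmetrizer_eq_qsym)
  show "qsym_kernel q \<subseteq> nichols_ideal q"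
  proof
    fix t assume t: "t \<in> qsym_kernel q"
    \<comment> \<open>The component of degree m. It stays in the kernel because the kernel is
      graded, and there it is a generator of the ideal.\<close>
    let ?t = "\<lambda>m. diagonal (\<lambda>M. if size M = m then 1 else 0) t"
    have "t = (\<Sum>m\<in>length ` Poly_Mapping.keys t. ?t m)"
    proof (rule poly_mapping_eqI)
      fix w
      have "(\<Sum>m\<in>length ` Poly_Mapping.keys t. poly_mapping.lookup (?t m) w) =
          (\<Sum>m\<in>length ` Poly_Mapping.keys t. if length w = m then poly_mapping.lookup t w else 0)"
        by (intro sum.cong) (simp_all add: lookup_diagonal)
      also have "\<dots> = poly_mapping.lookup t w"
        by (auto simp: sum.delta in_keys_iff image_iff)
      finally show "poly_mapping.lookup t w =
          poly_mapping.lookup (\<Sum>m\<in>length ` Poly_Mapping.keys t. ?t m) w"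
        by (simp add: lookup_sum)
    qed
    moreover have "?t m \<in> nichols_ideal q" for m
    proof -
      have m: "?t m \<in> tensor_power m"
        by (auto simp: tensor_power_def in_keys_iff lookup_diagonal split: if_splits)
      have "quantum_symmetrizer q m (?t m) = 0"
        using qsym_kernel_diagonal[OF t]
        by (simp add: quantum_symmetrizer_eq_qsym[OF m] qsym_kernel_def)
      with m show ?thesis
        unfolding nichols_ideal_def by (intro tensor.span_base) blast
    qed
    ultimately show "t \<in> nichols_ideal q"
      unfolding nichols_ideal_def by (metis (no_types, lifting) tensor.span_sum)
  qed
qed

section \<open>Compatibility of the bracket with the ideal\<close>

lemma tensor_bracket_word:
  "tensor_bracket q (word u) (word v) =
    word (v @ u) - Poly_Mapping.single (u @ v) (bichar q (wdeg v) (wdeg u))"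
  by (simp add: tensor_bracket_def)

lemma tlinear_bracket_left: "tlinear (\<lambda>x. tensor_bracket q x y)"
  unfolding tensor_bracket_def by (rule tlinear_lin_ext)

lemma tlinear_bracket_right: "tlinear (\<lambda>y. tensor_bracket q x y)"
  unfolding tensor_bracket_def lin_ext_def[of _ x]
  by (intro tlinear_sum tlinear_tscale tlinear_lin_ext)

lemma tensor_bracket_in_subspace:
  assumes "tensor.subspace S"
    and "\<And>u v. u \<in> Poly_Mapping.keys x \<Longrightarrow> v \<in> Poly_Mapping.keys y \<Longrightarrow>
      tensor_bracket q (word u) (word v) \<in> S"
  shows "tensor_bracket q x y \<in> S"
  unfolding tensor_bracket_def
  by (intro lin_ext_in_subspace assms(1)) (use assms(2) in \<open>simp add: tensor_bracket_word\<close>)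

text \<open>The degree as a function of the content, the form in which it can be a weight of
  \<open>diagonal\<close>.\<close>

definition mset_degree :: "'n multiset \<Rightarrow> int ^ ('n :: finite)" where
  "mset_degree M = (\<chi> i. int (count M i))"

lemma wdeg_eq_mset_degree: "wdeg w = mset_degree (mset w)"
  by (simp add: wdeg_def mset_degree_def count_mset)

lemma tlinear_diff: "tlinear f \<Longrightarrow> tlinear g \<Longrightarrow> tlinear (\<lambda>t. f t - g t)"
  by (rule tensor_pair.linear_compose_sub)

lemma tlinear_diagonal: "tlinear (diagonal \<phi>)"
  unfolding diagonal_def by (rule tlinear_lin_ext)

text \<open>Expresses the bracket through one-sided multiplications and a \<open>diagonal\<close>,
  all of which preserve the kernel.\<close>

lemma tensor_bracket_word_right:
  "tensor_bracket q x (word v) =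
    word v * x - diagonal (\<lambda>M. bichar q (wdeg v) (mset_degree M)) x * word v"
proof (rule tlinear_eqI[of "\<lambda>x. tensor_bracket q x (word v)"
      "\<lambda>x. word v * x - diagonal (\<lambda>M. bichar q (wdeg v) (mset_degree M)) x * word v"])
  show "tlinear (\<lambda>x. word v * x - diagonal (\<lambda>M. bichar q (wdeg v) (mset_degree M)) x * word v)"
    by (intro tlinear_diff tlinear_mult_left tlinear_comp[OF tlinear_mult_right tlinear_diagonal])
qed (auto simp: tlinear_bracket_left tensor_bracket_word single_times_single diagonal_def
    wdeg_eq_mset_degree)

lemma tensor_bracket_word_left:
  "tensor_bracket q (word u) y =
    y * word u - word u * diagonal (\<lambda>M. bichar q (mset_degree M) (wdeg u)) y"
proof (rule tlinear_eqI[of "\<lambda>y. tensor_bracket q (word u) y"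
      "\<lambda>y. y * word u - word u * diagonal (\<lambda>M. bichar q (mset_degree M) (wdeg u)) y"])
  show "tlinear (\<lambda>y. y * word u - word u * diagonal (\<lambda>M. bichar q (mset_degree M) (wdeg u)) y)"
    by (intro tlinear_diff tlinear_mult_right tlinear_comp[OF tlinear_mult_left tlinear_diagonal])
qed (auto simp: tlinear_bracket_right tensor_bracket_word single_times_single diagonal_def
    wdeg_eq_mset_degree)

lemma tensor_bracket_kernel_left:
  assumes "x \<in> qsym_kernel q"
  shows "tensor_bracket q x y \<in> qsym_kernel q"
proof -
  have "tensor_bracket q x y = lin_ext (\<lambda>v. tensor_bracket q x (word v)) y"
    by (rule lin_ext_eq[OF tlinear_bracket_right])
  also have "\<dots> \<in> qsym_kernel q"
    using assms unfolding tensor_bracket_word_right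
    by (intro lin_ext_in_subspace tensor.subspace_diff qsym_kernel_subspace qsym_kernel_word_left
        qsym_kernel_word_right qsym_kernel_diagonal)
  finally show ?thesis .
qed

lemma tensor_bracket_kernel_right:
  assumes "y \<in> qsym_kernel q"
  shows "tensor_bracket q x y \<in> qsym_kernel q"
proof -
  have "tensor_bracket q x y = lin_ext (\<lambda>u. tensor_bracket q (word u) y) x"
    by (rule lin_ext_eq[OF tlinear_bracket_left])
  also have "\<dots> \<in> qsym_kernel q"
    using assms unfolding tensor_bracket_word_left
    by (intro lin_ext_in_subspace tensor.subspace_diff qsym_kernel_subspace qsym_kernel_word_left
        qsym_kernel_word_right qsym_kernel_diagonal)
  finally show ?thesis .
qed

section \<open>Cosets and the operations induced on them\<close>

lemma mem_nichols_proj: "s \<in> nichols_proj q t \<longleftrightarrow> s - t \<in> qsym_kernel q"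
proof
  assume "s - t \<in> qsym_kernel q"
  then show "s \<in> nichols_proj q t"
    by (auto simp: nichols_proj_def nichols_ideal_eq_kernel a_r_coset_def r_coset_def
        ring_of_type_algebra_def intro: bexI[of _ "s - t"])
qed (auto simp: nichols_proj_def nichols_ideal_eq_kernel a_r_coset_def r_coset_def
    ring_of_type_algebra_def)

lemma nichols_proj_eq_iff: "nichols_proj q s = nichols_proj q t \<longleftrightarrow> s - t \<in> qsym_kernel q"
proof
  assume "nichols_proj q s = nichols_proj q t"
  then have "s \<in> nichols_proj q t"
    using tensor.subspace_0[OF qsym_kernel_subspace, of q] mem_nichols_proj[of s q s] by simp
  then show "s - t \<in> qsym_kernel q"
    by (simp add: mem_nichols_proj)
next
  assume st: "s - t \<in> qsym_kernel q"
  have "u - s \<in> qsym_kernel q \<longleftrightarrow> u - t \<in> qsym_kernel q" for u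
    using tensor.subspace_add[OF qsym_kernel_subspace _ st, of "u - s"]
      tensor.subspace_diff[OF qsym_kernel_subspace _ st, of "u - t"] by auto
  then show "nichols_proj q s = nichols_proj q t"
    by (auto simp: mem_nichols_proj)
qed

lemma nichols_proj_self: "t \<in> nichols_proj q t"
  using tensor.subspace_0[OF qsym_kernel_subspace] by (simp add: mem_nichols_proj)

text \<open>Scalar multiplication and bracket are defined as unions over all representatives; if F
  respects congruence, every member of the union is the same coset.\<close>

lemma UN_nichols_proj:
  assumes "\<And>s. s - t \<in> qsym_kernel q \<Longrightarrow> F s - F t \<in> qsym_kernel q"
  shows "(\<Union>s\<in>nichols_proj q t. nichols_proj q (F s)) = nichols_proj q (F t)"
proof -
  have "nichols_proj q (F s) = nichols_proj q (F t)" if "s \<in> nichols_proj q t" for s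
    using assms[of s] that by (simp add: nichols_proj_eq_iff mem_nichols_proj)
  then show ?thesis
    using nichols_proj_self[of t q] by blast
qed

lemma nichols_carrier: "carrier (nichols_algebra q) = range (nichols_proj q)"
  by (auto simp: nichols_algebra_def ring.defs module.defs FactRing_def A_RCOSETS_def RCOSETS_def
      nichols_proj_def a_r_coset_def ring_of_type_algebra_def)

lemma nichols_zero: "\<zero>\<^bsub>nichols_algebra q\<^esub> = nichols_proj q 0"
proof -
  have "\<zero>\<^bsub>nichols_algebra q\<^esub> = nichols_ideal q"
    by (simp add: nichols_algebra_def ring.defs module.defs FactRing_def)
  also have "\<dots> = nichols_proj q 0"
    unfolding nichols_ideal_eq_kernel by (rule Set.set_eqI) (simp add: mem_nichols_proj)
  finally show ?thesis .
qed

lemma nichols_one: "\<one>\<^bsub>nichols_algebra q\<^esub> = nichols_proj q 1"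
  unfolding nichols_algebra_def ring.defs module.defs FactRing_def nichols_proj_def
  by (simp add: ring_of_type_algebra_def)

lemma nichols_add:
  "nichols_proj q s \<oplus>\<^bsub>nichols_algebra q\<^esub> nichols_proj q t = nichols_proj q (s + t)"
proof -
  have "nichols_proj q s \<oplus>\<^bsub>nichols_algebra q\<^esub> nichols_proj q t =
      {x + y |x y. x \<in> nichols_proj q s \<and> y \<in> nichols_proj q t}"
    by (auto simp: nichols_algebra_def ring.defs module.defs FactRing_def set_add_def set_mult_def
        ring_of_type_algebra_def)
  also have "\<dots> = nichols_proj q (s + t)"
  proof (intro equalityI subsetI)
    fix z assume "z \<in> {x + y |x y. x \<in> nichols_proj q s \<and> y \<in> nichols_proj q t}"
    then show "z \<in> nichols_proj q (s + t)"
      using tensor.subspace_add[OF qsym_kernel_subspace]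
      by (auto simp: mem_nichols_proj add_diff_add)
  next
    fix z assume "z \<in> nichols_proj q (s + t)"
    then have "z - t \<in> nichols_proj q s"
      by (simp add: mem_nichols_proj algebra_simps)
    then show "z \<in> {x + y |x y. x \<in> nichols_proj q s \<and> y \<in> nichols_proj q t}"
      using nichols_proj_self[of t q] by (metis (mono_tags, lifting) diff_add_cancel mem_Collect_eq)
  qed
  finally show ?thesis .
qed

lemma nichols_smult:
  "c \<odot>\<^bsub>nichols_algebra q\<^esub> nichols_proj q t = nichols_proj q (tscale c t)"
proof -
  have "c \<odot>\<^bsub>nichols_algebra q\<^esub> nichols_proj q t =
      (\<Union>s\<in>nichols_proj q t. nichols_proj q (tscale c s))"
    by (simp add: nichols_algebra_def ring.defs module.defs FactRing_def)
  also have "\<dots> = nichols_proj q (tscale c t)"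
    using tensor.subspace_scale[OF qsym_kernel_subspace]
    by (intro UN_nichols_proj) (simp flip: tensor.scale_right_diff_distrib)
  finally show ?thesis .
qed

lemma nichols_bracket_proj:
  "nichols_bracket q (nichols_proj q x) (nichols_proj q y) = nichols_proj q (tensor_bracket q x y)"
proof -
  have "(\<Union>y'\<in>nichols_proj q y. nichols_proj q (tensor_bracket q x' y')) =
      nichols_proj q (tensor_bracket q x' y)" for x'
    using tensor_bracket_kernel_right[of "_ - y" q x']
    by (intro UN_nichols_proj) (simp add: tensor_pair.linear_diff[OF tlinear_bracket_right])
  moreover have "(\<Union>x'\<in>nichols_proj q x. nichols_proj q (tensor_bracket q x' y)) =
      nichols_proj q (tensor_bracket q x y)"
    using tensor_bracket_kernel_left[of "_ - x" q y]
    by (intro UN_nichols_proj) (simp add: tensor_pair.linear_diff[OF tlinear_bracket_left])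
  ultimately show ?thesis
    by (simp add: nichols_bracket_def)
qed

lemma nichols_module:
  "module (ring_of_type_algebra :: 'a :: field ring) (nichols_algebra (q :: 'n \<Rightarrow> 'n \<Rightarrow> 'a))"
proof (rule moduleI)
  show "cring (ring_of_type_algebra :: 'a ring)"
    by (rule cring_from_type_algebra)
  show "abelian_group (nichols_algebra q)"
  proof (rule abelian_groupI)
    fix x assume "x \<in> carrier (nichols_algebra q)"
    then obtain s where "x = nichols_proj q s"
      by (auto simp: nichols_carrier)
    then have "nichols_proj q (- s) \<oplus>\<^bsub>nichols_algebra q\<^esub> x = \<zero>\<^bsub>nichols_algebra q\<^esub>"
      by (simp add: nichols_add nichols_zero)
    then show "\<exists>y\<in>carrier (nichols_algebra q). y \<oplus>\<^bsub>nichols_algebra q\<^esub> x = \<zero>\<^bsub>nichols_algebra q\<^esub>"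
      by (auto simp: nichols_carrier)
  qed (auto simp: nichols_carrier nichols_add nichols_zero add_ac)
qed (auto simp: nichols_carrier nichols_add nichols_smult ring_of_type_algebra_def
    tensor.scale_left_distrib tensor.scale_right_distrib)

section \<open>The bicharacter and the degrees of words\<close>

lemma bichar_axis: "bichar q (axis i 1) (axis j 1) = q i j"
proof -
  have "q k l powi (axis i 1 $ k * axis j 1 $ l) = (if l = j then if k = i then q i j else 1 else 1)"
    for k l
    by (simp add: axis_def)
  then have "bichar q (axis i 1) (axis j 1) =
      (\<Prod>k\<in>UNIV. \<Prod>l\<in>UNIV. if l = j then if k = i then q i j else 1 else 1)"
    unfolding bichar_def by (intro prod.cong) auto
  then show ?thesis
    by (simp add: prod.delta)
qed

lemma bichar_zero_left [simp]: "bichar q 0 \<beta> = 1"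
  by (simp add: bichar_def)

lemma bichar_zero_right [simp]: "bichar q \<alpha> 0 = 1"
  by (simp add: bichar_def)

context
  fixes q :: "'n :: finite \<Rightarrow> 'n \<Rightarrow> 'a :: field"
  assumes nonzero: "\<And>i j. q i j \<noteq> 0"
begin

lemma bichar_add_left: "bichar q (\<alpha> + \<beta>) \<gamma> = bichar q \<alpha> \<gamma> * bichar q \<beta> \<gamma>"
  by (simp add: bichar_def nonzero distrib_right power_int_add prod.distrib)

lemma bichar_add_right: "bichar q \<alpha> (\<beta> + \<gamma>) = bichar q \<alpha> \<beta> * bichar q \<alpha> \<gamma>"
  by (simp add: bichar_def nonzero distrib_left power_int_add prod.distrib)

lemma bichar_nonzero: "bichar q \<alpha> \<beta> \<noteq> 0"
  by (simp add: bichar_def nonzero)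

end

lemma wdeg_Nil [simp]: "wdeg [] = 0"
  by (simp add: wdeg_def vec_eq_iff)

lemma wdeg_Cons: "wdeg (i # w) = axis i 1 + wdeg w"
  by (simp add: wdeg_def vec_eq_iff axis_def)

lemma wdeg_append: "wdeg (u @ v) = wdeg u + wdeg v"
  by (simp add: wdeg_def vec_eq_iff)

text \<open>The empty word falls under the first alternative, where \<open>hd []\<close> is repeated
  zero times. The second one finds the place to which a nonconstant word is rotated.\<close>

lemma not_constant_imp_adjacent_distinct:
  "w = replicate (length w) (hd w) \<or> (\<exists>u i j v. i \<noteq> j \<and> w = u @ i # j # v)"
proof (induction w)
  case (Cons a w)
  then show ?case
  proof
    assume w: "w = replicate (length w) (hd w)"
    show ?thesis
    proof (cases "w = [] \<or> hd w = a")
      case True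
      with w show ?thesis
        by (metis length_0_conv length_Cons list.sel(1) replicate_Suc replicate_0)
    next
      case False
      then have "a # w = [] @ a # hd w # tl w"
        by simp
      with False show ?thesis by metis
    qed
  next
    assume "\<exists>u i j v. i \<noteq> j \<and> w = u @ i # j # v"
    then show ?thesis by (metis append_Cons)
  qed
qed simp

section \<open>Subspaces closed under the bracket\<close>

text \<open>S models the preimage in T(V) of a submodule containing V and closed under the bracket.
  Connectedness appears in its rank-two form, with an edge between any two distinct letters.\<close>

locale bracket_closed_subspace =
  fixes q :: "'n :: finite \<Rightarrow> 'n \<Rightarrow> 'a :: field" and S :: "('n, 'a) tensor set"
  assumes nonzero: "q i j \<noteq> 0"
    and diagonal_not_one: "q i i \<noteq> 1"
    and connected: "i \<noteq> j \<Longrightarrow> q i j * q j i \<noteq> 1"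
    and subspace: "tensor.subspace S"
    and letter: "word [i] \<in> S"
    and bracket: "x \<in> S \<Longrightarrow> y \<in> S \<Longrightarrow> tensor_bracket q x y \<in> S"
    and kernel: "qsym_kernel q \<subseteq> S"
begin

text \<open>The rotation step: modulo S, exchanging two blocks of a word costs only a scalar,
  provided that both blocks lie in S.\<close>

lemma bracket_word:
  assumes "word u \<in> S" "word v \<in> S"
  shows "word (v @ u) - tscale (bichar q (wdeg v) (wdeg u)) (word (u @ v)) \<in> S"
  using bracket[OF assms] by (simp add: tensor_bracket_word)

lemma scaled_mem: "tscale c t \<in> S \<Longrightarrow> c \<noteq> 0 \<Longrightarrow> t \<in> S"
  using tensor.subspace_scale[OF subspace, of "tscale c t" "inverse c"] by simp

lemma rotate_mem:
  assumes "word u \<in> S" "word v \<in> S" "word (u @ v) \<in> S"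
  shows "word (v @ u) \<in> S"
  using tensor.subspace_add[OF subspace bracket_word[OF assms(1,2)]
      tensor.subspace_scale[OF subspace assms(3), of "bichar q (wdeg v) (wdeg u)"]] by simp

text \<open>
  Modulo \<open>S\<close>, \<open>x\<^sub>i x\<^sub>j w\<close> can be turned into a multiple of \<open>w x\<^sub>i x\<^sub>j\<close> by moving the two letters
  one after the other or both at once. The two factors differ by \<open>q\<^sub>i\<^sub>j q\<^sub>j\<^sub>i \<noteq> 1\<close>.
\<close>

lemma two_letters_mem:
  assumes "i \<noteq> j" "word (j # w) \<in> S" "word (w @ [i]) \<in> S" "word w \<in> S" "word [i, j] \<in> S"
  shows "word (i # j # w) \<in> S"
proof -
  define a b c :: "('n, 'a) tensor"
    where "a = word (i # j # w)" and "b = word (j # w @ [i])" and "c = word (w @ [i, j])"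
  define x y where "x = bichar q (wdeg [i]) (wdeg (j # w))" and "y = bichar q (wdeg [j]) (wdeg (w @ [i]))"
  define z where "z = bichar q (wdeg [i, j]) (wdeg w)"
  have ab: "a - tscale x b \<in> S"
    using bracket_word[OF assms(2) letter[of i]] by (simp add: a_def b_def x_def)
  have bc: "b - tscale y c \<in> S"
    using bracket_word[OF assms(3) letter[of j]] by (simp add: b_def c_def y_def)
  have ac: "a - tscale z c \<in> S"
    using bracket_word[OF assms(4,5)] by (simp add: a_def c_def z_def)
  have "(a - tscale x b) + tscale x (b - tscale y c) - (a - tscale z c) \<in> S"
    by (rule tensor.subspace_diff[OF subspace tensor.subspace_add[OF subspace ab
          tensor.subspace_scale[OF subspace bc]] ac])
  moreover have "(a - tscale x b) + tscale x (b - tscale y c) - (a - tscale z c) =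
      tscale (z - x * y) c"
    by (simp add: tensor.scale_right_diff_distrib tensor.scale_left_diff_distrib)
  \<comment> \<open>Moved separately, i passes j and later j passes i; moved as a block, they never
    cross. The remaining factors come from passing w and agree.\<close>
  moreover have "x * y = z * (q i j * q j i)"
    by (simp add: x_def y_def z_def wdeg_Cons wdeg_append bichar_add_left[OF nonzero]
        bichar_add_right[OF nonzero] bichar_axis)
  moreover have "z \<noteq> 0"
    by (simp add: z_def bichar_nonzero[OF nonzero])
  ultimately have "c \<in> S"
    using scaled_mem[of "z - x * y" c] connected[OF assms(1)] by simp
  with ac show ?thesis
    using tensor.subspace_add[OF subspace ac tensor.subspace_scale[OF subspace, of c z]]
    by (simp add: a_def)
qed

lemma replicate_mem: "word (replicate (Suc n) i) \<in> S"
proof (induction n)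
  case 0
  show ?case using letter by simp
next
  case (Suc n)
  let ?r = "replicate (Suc n) i"
  show ?case
  proof (cases "q i i ^ Suc n = 1")
    case True
    have "(1 - q i i) * (\<Sum>k\<le>n. q i i ^ k) = 1 - q i i ^ Suc n"
      using one_diff_power_eq[of "q i i" "Suc n"] by (simp only: lessThan_Suc_atMost)
    with True have "(\<Sum>k\<le>n. q i i ^ k) = 0"
      using diagonal_not_one[of i] by simp
    \<comment> \<open>The vanishing sum is the factor with l = n in the q-factorial of n + 1. Thus
      the shorter power is already in the ideal, and multiplying by x_i gives the claim.\<close>
    then have "qsym q ?r = 0"
      unfolding qsym_replicate by simp
    then have "word ?r \<in> qsym_kernel q"
      unfolding qsym_kernel_def by simp
    from qsym_kernel_word_left[OF this, of "[i]"] kernel show ?thesis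
      by (auto simp: single_times_single)
  next
    case False
    have "bichar q (wdeg [i]) (wdeg (replicate m i)) = q i i ^ m" for m
      by (induction m) (simp_all add: wdeg_Cons bichar_add_right[OF nonzero] bichar_axis)
    then have "bichar q (wdeg [i]) (wdeg ?r) = q i i ^ Suc n" .
    moreover have "?r @ [i] = [i] @ ?r"
      by (simp add: replicate_append_same)
    ultimately have "word ([i] @ ?r) - tscale (q i i ^ Suc n) (word ([i] @ ?r)) \<in> S"
      using bracket_word[OF Suc letter[of i]] by metis
    then have "tscale (1 - q i i ^ Suc n) (word ([i] @ ?r)) \<in> S"
      by (simp only: tensor.scale_left_diff_distrib tensor.scale_one)
    with False show ?thesis
      using scaled_mem[of "1 - q i i ^ Suc n" "word ([i] @ ?r)"] by simp
  qed
qed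

lemma word_mem: "w \<noteq> [] \<Longrightarrow> word w \<in> S"
proof (induction w rule: length_induct)
  case (1 w)
  from not_constant_imp_adjacent_distinct[of w] show ?case
  proof
    assume "w = replicate (length w) (hd w)"
    moreover obtain n where "length w = Suc n"
      using "1.prems" by (cases w) auto
    ultimately show ?thesis
      using replicate_mem[of n "hd w"] by simp
  next
    assume "\<exists>u i j v. i \<noteq> j \<and> w = u @ i # j # v"
    then obtain u i j v where ij: "i \<noteq> j" and w: "w = u @ i # j # v"
      by blast
    have IH: "word w' \<in> S" if "length w' < length w" "w' \<noteq> []" for w'
      using that "1.IH" by blast
    \<comment> \<open>Words of length two are treated apart: if v @ u is empty,
      \<open>word [i, j]\<close> is not covered by the induction hypothesis. There, exchanging the
      letters twice returns x_i x_j times q_ij q_ji.\<close>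
    show ?thesis
    proof (cases "v @ u = []")
      case True
      have "word [i, j] - tscale (q i j) (word [j, i]) \<in> S"
        using bracket_word[OF letter[of j] letter[of i]] by (simp add: wdeg_Cons bichar_axis)
      moreover have "word [j, i] - tscale (q j i) (word [i, j]) \<in> S"
        using bracket_word[OF letter[of i] letter[of j]] by (simp add: wdeg_Cons bichar_axis)
      ultimately have "(word [i, j] - tscale (q i j) (word [j, i])) +
          tscale (q i j) (word [j, i] - tscale (q j i) (word [i, j])) \<in> S"
        by (intro tensor.subspace_add[OF subspace] tensor.subspace_scale[OF subspace])
      then have "tscale (1 - q i j * q j i) (word [i, j]) \<in> S"
        by (simp only: tensor.scale_right_diff_distrib tensor.scale_left_diff_distrib
            tensor.scale_scale tensor.scale_one diff_add_cancel add_diff_eq)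
      with True w show ?thesis
        using scaled_mem[of "1 - q i j * q j i" "word [i, j]"] connected[OF ij] by simp
    next
      case False
      then have "word (j # v @ u) \<in> S" "word ((v @ u) @ [i]) \<in> S" "word (v @ u) \<in> S"
        "word [i, j] \<in> S"
        by (auto intro!: IH simp: w)
      then have "word (i # j # v @ u) \<in> S"
        by (rule two_letters_mem[OF ij])
      then have rotated: "word ((i # j # v) @ u) \<in> S"
        by simp
      \<comment> \<open>It remains to undo the rotation. This needs u itself to be in S, which the
        induction hypothesis provides only for nonempty u.\<close>
      show ?thesis
      proof (cases "u = []")
        case True
        with rotated show ?thesis
          by (simp add: w)
      next
        case False
        then have "word (i # j # v) \<in> S" "word u \<in> S"
          by (auto intro!: IH simp: w)
        from rotate_mem[OF this rotated] show ?thesis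
          by (simp add: w)
      qed
    qed
  qed
qed

end

section \<open>Splitting the rank-two Nichols algebra into scalars and the braided Lie
  algebra\<close>

theorem corollary3p6:
  fixes q :: "'n :: finite \<Rightarrow> 'n \<Rightarrow> 'a :: field_char_0"
  assumes "\<And>i j. q i j \<noteq> 0"
    and "connected_braiding q"
    and "arithmetic_root_system q"
    and "CARD('n) = 2"
  shows "carrier (nichols_algebra q) = nichols_scalars q <+>\<^bsub>nichols_algebra q\<^esub> braided_lie q \<and>
    nichols_scalars q \<inter> braided_lie q = {\<zero>\<^bsub>nichols_algebra q\<^esub>}"
proof -
  let ?B = "nichols_algebra q"
  interpret module "ring_of_type_algebra :: 'a ring" ?B
    by (rule nichols_module)
  have card: "k = i \<or> k = j" if "i \<noteq> j" for i j k :: 'n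
    using assms(4) that unfolding card_2_iff by (metis UNIV_I empty_iff insert_iff)
  \<comment> \<open>The first edge of a path from i to j leaves i, and with only two letters it must
    end in j.\<close>
  have connected: "q i j * q j i \<noteq> 1" if ij: "i \<noteq> j" for i j
  proof -
    have "(i, j) \<in> {(i, j). i \<noteq> j \<and> q i j * q j i \<noteq> 1}\<^sup>*"
      using assms(2) by (simp add: connected_braiding_def)
    then obtain k where "i \<noteq> k" "q i k * q k i \<noteq> 1"
      using ij by (auto elim: converse_rtranclE)
    with card[OF ij, of k] show ?thesis
      by auto
  qed
  have diagonal: "q i i \<noteq> 1" for i
  proof
    assume qi: "q i i = 1"
    obtain j where j: "j \<noteq> i"
      using assms(4) unfolding card_2_iff by (metis UNIV_I empty_iff insert_iff)
    have "reflection_defined q (\<lambda>i. axis i 1) i"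
      using assms(3) weyl_groupoid.base unfolding arithmetic_root_system_def by blast
    then obtain m where "cartan_cond q (\<lambda>i. axis i 1) i j m"
      using j unfolding reflection_defined_def by blast
    \<comment> \<open>At q_ii = 1 the q-number of m + 1 is the integer m + 1 and the power q_ii^m
      disappears; neither remaining factor can vanish.\<close>
    then have "of_nat (Suc m) * (q i j * q j i - 1) = 0"
      by (simp add: cartan_cond_def bichar_axis qi)
    then show False
      using connected[of i j] j by (simp del: of_nat_Suc)
  qed
  define \<W> where "\<W> = {W. submodule W ring_of_type_algebra ?B \<and> nichols_V q \<subseteq> W \<and>
      (\<forall>A\<in>W. \<forall>B\<in>W. nichols_bracket q A B \<in> W)}"
  have lie: "braided_lie q = \<Inter>\<W>"
    by (simp add: braided_lie_def \<W>_def)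
  \<comment> \<open>The image of Z will be all of \<open>braided_lie q\<close>: it is one of the
    submodules being intersected, and it lies in each of them because nonempty words do.\<close>
  define Z :: "('n, 'a) tensor set" where "Z = {t. poly_mapping.lookup t [] = 0}"
  have Z: "tensor.subspace Z"
    by (rule tensor.subspaceI) (simp_all add: Z_def lookup_add)
  have "nichols_proj q ` Z \<in> \<W>"
    unfolding \<W>_def
  proof (intro CollectI conjI ballI)
    show "submodule (nichols_proj q ` Z) ring_of_type_algebra ?B"
    proof (rule submoduleI)
      fix A assume "A \<in> nichols_proj q ` Z"
      then obtain t where t: "A = nichols_proj q t" "t \<in> Z"
        by blast
      have "\<ominus>\<^bsub>?B\<^esub> A = nichols_proj q (- t)"
        by (rule minus_equality) (simp_all add: t nichols_add nichols_zero nichols_carrier)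
      with t show "\<ominus>\<^bsub>?B\<^esub> A \<in> nichols_proj q ` Z"
        using tensor.subspace_neg[OF Z] by simp
    qed (auto simp: nichols_carrier nichols_zero nichols_add nichols_smult
        tensor.subspace_0[OF Z] tensor.subspace_add[OF Z] tensor.subspace_scale[OF Z])
    show "nichols_V q \<subseteq> nichols_proj q ` Z"
      unfolding nichols_V_def
      by (rule image_mono) (auto simp: tensor_power_def Z_def simp flip: not_in_keys_iff_lookup_eq_zero)
    fix A B assume "A \<in> nichols_proj q ` Z" "B \<in> nichols_proj q ` Z"
    \<comment> \<open>Every bracket lies in Z, whatever x and y are: even [1, 1] = 1 - 1 = 0 has no
      constant term.\<close>
    moreover have "tensor_bracket q x y \<in> Z" for x y
      by (rule tensor_bracket_in_subspace[OF Z])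
        (auto simp: tensor_bracket_word Z_def lookup_minus lookup_single when_def)
    ultimately show "nichols_bracket q A B \<in> nichols_proj q ` Z"
      by (auto simp: nichols_bracket_proj)
  qed
  then have lie_subset: "braided_lie q \<subseteq> nichols_proj q ` Z"
    unfolding lie by blast
  have subset_lie: "nichols_proj q t \<in> braided_lie q" if t: "t \<in> Z" for t
    unfolding lie
  proof
    fix W assume "W \<in> \<W>"
    then have W: "submodule W ring_of_type_algebra ?B" and V: "nichols_V q \<subseteq> W"
      and br: "\<And>A B. A \<in> W \<Longrightarrow> B \<in> W \<Longrightarrow> nichols_bracket q A B \<in> W"
      by (auto simp: \<W>_def)
    define S where "S = {t. nichols_proj q t \<in> W}"
    have zero: "nichols_proj q 0 \<in> W"
      using subgroup.one_closed[OF submodule.axioms(1)[OF W]] by (simp add: nichols_zero)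
    have S: "tensor.subspace S"
    proof (rule tensor.subspaceI)
      fix c x assume "x \<in> S"
      then show "tscale c x \<in> S"
        using submoduleE(4)[OF W, of c "nichols_proj q x"]
        by (simp add: S_def nichols_smult ring_of_type_algebra_def)
    qed (use zero submoduleE(5)[OF W] in \<open>auto simp: S_def simp flip: nichols_add\<close>)
    interpret bracket_closed_subspace q S
    proof
      show "word [i] \<in> S" for i
        using V by (auto simp: S_def nichols_V_def tensor_power_def)
      show "qsym_kernel q \<subseteq> S"
      proof
        fix t assume "t \<in> qsym_kernel q"
        then have "nichols_proj q t = nichols_proj q 0"
          by (simp add: nichols_proj_eq_iff)
        with zero show "t \<in> S"
          by (simp add: S_def)
      qed
      show "tensor_bracket q x y \<in> S" if "x \<in> S" "y \<in> S" for x y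
        using br that by (simp add: S_def flip: nichols_bracket_proj)
    qed (use assms(1) diagonal connected S in auto)
    have "lin_ext word t \<in> S"
      using t by (intro lin_ext_in_subspace S word_mem) (auto simp: Z_def in_keys_iff)
    moreover have "lin_ext word t = t"
      unfolding lin_ext_def by (rule tensor_eq_sum_words[symmetric])
    ultimately show "nichols_proj q t \<in> W"
      by (simp add: S_def)
  qed
  have scalars: "nichols_scalars q = range (\<lambda>c. nichols_proj q (tscale c 1))"
    by (simp add: nichols_scalars_def nichols_one nichols_smult)
  have lookup_1: "poly_mapping.lookup (1 :: ('n, 'a) tensor) [] = 1"
    by (simp flip: word_Nil)
  show ?thesis
  proof
    show "carrier ?B = nichols_scalars q <+>\<^bsub>?B\<^esub> braided_lie q"
    proof
      show "carrier ?B \<subseteq> nichols_scalars q <+>\<^bsub>?B\<^esub> braided_lie q"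
      proof
        fix A assume "A \<in> carrier ?B"
        then obtain t where A: "A = nichols_proj q t"
          by (auto simp: nichols_carrier)
        let ?c = "tscale (poly_mapping.lookup t []) 1"
        have "A = nichols_proj q ?c \<oplus>\<^bsub>?B\<^esub> nichols_proj q (t - ?c)"
          by (simp add: A nichols_add)
        moreover have "nichols_proj q (t - ?c) \<in> braided_lie q"
          by (rule subset_lie) (simp add: Z_def lookup_minus lookup_1)
        ultimately show "A \<in> nichols_scalars q <+>\<^bsub>?B\<^esub> braided_lie q"
          unfolding scalars set_add_def' by blast
      qed
      show "nichols_scalars q <+>\<^bsub>?B\<^esub> braided_lie q \<subseteq> carrier ?B"
        using lie_subset by (fastforce simp: scalars set_add_def' nichols_carrier nichols_add)
    qed
    show "nichols_scalars q \<inter> braided_lie q = {\<zero>\<^bsub>?B\<^esub>}"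
    proof (intro equalityI subsetI)
      fix A assume "A \<in> nichols_scalars q \<inter> braided_lie q"
      then obtain c where A: "A = nichols_proj q (tscale c 1)" and "A \<in> braided_lie q"
        by (auto simp: scalars)
      then obtain t where t: "A = nichols_proj q t" "t \<in> Z"
        using lie_subset by blast
      with A have "tscale c 1 - t \<in> qsym_kernel q"
        by (simp flip: nichols_proj_eq_iff)
      \<comment> \<open>The constant term of this element of the ideal is c, since t has
        none.\<close>
      then have "c = 0"
        using qsym_kernel_lookup_Nil[of _ q] t(2) by (fastforce simp: Z_def lookup_minus lookup_1)
      then show "A \<in> {\<zero>\<^bsub>?B\<^esub>}"
        by (simp add: A nichols_zero)
    next
      fix A assume "A \<in> {\<zero>\<^bsub>?B\<^esub>}"
      then have A: "A = nichols_proj q 0"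
        by (simp add: nichols_zero)
      have "A \<in> nichols_scalars q"
        unfolding A scalars by (rule range_eqI[of _ _ 0]) simp
      moreover have "A \<in> braided_lie q"
        unfolding A by (rule subset_lie) (simp add: Z_def)
      ultimately show "A \<in> nichols_scalars q \<inter> braided_lie q"
        by blast
    qed
  qed
qed

end
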